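(* The map $\delta_{\mathrm{MOD}}$ is coassociative, i.e. $(\delta_{\mathrm{MOD}}\otimes\mathrm{id})\circ\delta_{\mathrm{MOD}}=(\mathrm{id}\otimes\delta_{\mathrm{MOD}})\circ\delta_{\mathrm{MOD}}$ on $\mathrm{MOD}[I]$ for every finite set $I$; and the map $\delta_{\mathrm{SM}}$ makes $\mathrm{SM}$ a (right) comodule over the comonoid $(\mathrm{MOD},\delta_{\mathrm{MOD}},\varepsilon_{\mathrm{MOD}})$, i.e. $(\delta_{\mathrm{SM}}\otimes\mathrm{id})\circ\delta_{\mathrm{SM}}=(\mathrm{id}\otimes\delta_{\mathrm{MOD}})\circ\delta_{\mathrm{SM}}$ and $(\mathrm{id}\otimes\varepsilon_{\mathrm{MOD}})\circ\delta_{\mathrm{SM}}=\mathrm{id}$ on $\mathrm{SM}[I]$ for every finite set $I$.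
   Context: $\hat{\mathbb R}=\mathbb R\cup\{\infty\}$. A function $z:\mathcal P(I)\to\hat{\mathbb R}$ ($I$ finite) with $z(\emptyset)=0$, $z(I)<\infty$ is submodular if $z(A\cup B)+z(A\cap B)\le z(A)+z(B)$ for all $A,B$, and modular if equality always holds. For $A\subseteq B\subseteq I$ with $z(A),z(B)<\infty$, $z_{B/A}(U)=z(A\cup U)-z(A)$ for $U\subseteq B\setminus A$. Product of functions on disjoint sets: $(u\cdot v)(E)=u(E\cap S)+v(E\cap T)$ for $E\subseteq S\sqcup T$. $z'$ on $C$ decomposes along $C=C_1\sqcup C_2$ if $z'(E)=z'(E\cap C_1)+z'(E\cap C_2)$ for all $E\subseteq C$. A preorder is a reflexive transitive relation; bubbles are the classes of $x\le y\le x$; down-sets contain everything below their elements; convex subsets are $C=B\setminus A$ with $A\subseteq B$ down-sets; $C=C_1\sqcup C_2$ is a disconnected union if no element of $C_1$ is comparable to one of $C_2$; a totally disconnected preorder is an equivalence relation. $P$ is compatible with $z$ if $z(A)<\infty$ for all down-sets $A$, and for down-sets $A\subseteq B$ with $B\setminus A=C_1\sqcup C_2$ a disconnected union, $z_{B/A}$ decomposes along $C_1\sqcup C_2$; then $z_{B/A}$ depends only on $C=B\setminus A$ and is written $z_C$. $P$ conforms to $z$ if moreover, for convex $C$, a decomposition of $z_C$ along $C=C_1\sqcup C_2$ implies that $C=C_1\sqcup C_2$ is a disconnected union in $P$. $\mathrm{Pre}(z)$ is the set of preorders conforming to $z$. For $P$ compatible with $z$: $z_P=\prod_{C\text{ bubble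 of }P}z_C$; $z^P(A)=z(A)$ if $A$ is a down-set of $P$ and $\infty$ otherwise ($z^P$ is modular; if $z$ is modular so is $z_P$). $\mathrm{pre}(z)$ is the preorder whose down-sets are the $A$ with $z(A)<\infty$. $\mathrm{SM}[I]$ (resp. $\mathrm{MOD}[I]$) is the real vector space with basis the submodular (resp. modular) functions on $I$. $\delta_{\mathrm{SM}}:\mathrm{SM}[I]\to\mathrm{SM}[I]\otimes\mathrm{MOD}[I]$ is $\delta_{\mathrm{SM}}(z)=\sum_{Q\in\mathrm{Pre}(z)}z_Q\otimes z^Q$, and $\delta_{\mathrm{MOD}}:\mathrm{MOD}[I]\to\mathrm{MOD}[I]\otimes\mathrm{MOD}[I]$ is its restriction. $\varepsilon_{\mathrm{MOD}}:\mathrm{MOD}[I]\to\mathbb R$ is $1$ on $z$ if $\mathrm{pre}(z)$ is totally disconnected and $0$ otherwise.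
   Formalization: "Modular" is taken to mean that equality holds whenever z(A) and z(B) are finite; requiring it for infinite values too would force z to be finite everywhere, so that z^P would not be modular and δ_SM would not map into SM⊗MOD. *)

theory Defs
  imports "HOL-Analysis.Analysis" "HOL-Analysis.Finite_Function_Topology"
begin

section \<open>Free real vector spaces and tensor products\<close>

text \<open>
  The real vector space with basis \<open>X\<close> is the span of the unit vectors \<open>basis_vec x\<close>,
  \<open>x \<in> X\<close>, among the finitely supported real functions. The tensor product of the spaces with
  bases \<open>X\<close> and \<open>Y\<close> is realised as the space with basis \<open>X \<times> Y\<close>.
\<close>

definition basis_vec :: "'b \<Rightarrow> 'b \<Rightarrow>\<^sub>0 real" where
  "basis_vec b = Poly_Mapping.single b 1"

definition free_space :: "'b set \<Rightarrow> ('b \<Rightarrow>\<^sub>0 real) set" where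
  "free_space X = span (basis_vec ` X)"

definition lin_extend :: "('b \<Rightarrow> 'w::real_vector) \<Rightarrow> ('b \<Rightarrow>\<^sub>0 real) \<Rightarrow> 'w" where
  "lin_extend f v = (\<Sum>b\<in>Poly_Mapping.keys v. Poly_Mapping.lookup v b *\<^sub>R f b)"

definition tensor :: "('b \<Rightarrow>\<^sub>0 real) \<Rightarrow> ('c \<Rightarrow>\<^sub>0 real) \<Rightarrow> ('b \<times> 'c \<Rightarrow>\<^sub>0 real)" where
  "tensor u v = lin_extend (\<lambda>b. lin_extend (\<lambda>c. basis_vec (b, c)) v) u"

definition tensor_space ::
  "('b \<Rightarrow>\<^sub>0 real) set \<Rightarrow> ('c \<Rightarrow>\<^sub>0 real) set \<Rightarrow> ('b \<times> 'c \<Rightarrow>\<^sub>0 real) set" where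
  "tensor_space V W = span {tensor u v |u v. u \<in> V \<and> v \<in> W}"

text \<open>
  Tensor product of linear maps, determined by its values on basis vectors; see
  \<open>tensor_map_tensor\<close> below. The values of \<open>f\<close> and \<open>g\<close> matter only on the basis vectors
  occurring in the argument, so \<open>f\<close> and \<open>g\<close> may be defined on subspaces only.
\<close>

definition tensor_map ::
  "(('b \<Rightarrow>\<^sub>0 real) \<Rightarrow> ('d \<Rightarrow>\<^sub>0 real)) \<Rightarrow> (('c \<Rightarrow>\<^sub>0 real) \<Rightarrow> ('e \<Rightarrow>\<^sub>0 real))
    \<Rightarrow> ('b \<times> 'c \<Rightarrow>\<^sub>0 real) \<Rightarrow> ('d \<times> 'e \<Rightarrow>\<^sub>0 real)" where
  "tensor_map f g = lin_extend (\<lambda>(b, c). tensor (f (basis_vec b)) (g (basis_vec c)))"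

text \<open>\<open>f \<otimes> \<phi>\<close> for a functional \<open>\<phi>\<close>, followed by the identification of \<open>V \<otimes> \<real>\<close> with \<open>V\<close>.\<close>

definition tensor_functional ::
  "(('b \<Rightarrow>\<^sub>0 real) \<Rightarrow> ('d \<Rightarrow>\<^sub>0 real)) \<Rightarrow> (('c \<Rightarrow>\<^sub>0 real) \<Rightarrow> real)
    \<Rightarrow> ('b \<times> 'c \<Rightarrow>\<^sub>0 real) \<Rightarrow> ('d \<Rightarrow>\<^sub>0 real)" where
  "tensor_functional f \<phi> = lin_extend (\<lambda>(b, c). \<phi> (basis_vec c) *\<^sub>R f (basis_vec b))"

definition tensor_assoc ::
  "(('b \<times> 'c) \<times> 'd \<Rightarrow>\<^sub>0 real) \<Rightarrow> ('b \<times> 'c \<times> 'd \<Rightarrow>\<^sub>0 real)" where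
  "tensor_assoc = lin_extend (\<lambda>((b, c), d). basis_vec (b, c, d))"

lemma lookup_scaleR_real: "Poly_Mapping.lookup (r *\<^sub>R v) b = r * (Poly_Mapping.lookup v b :: real)"
proof -
  have "finite {i. r *\<^sub>R Poly_Mapping.lookup v i \<noteq> 0}"
    by (rule finite_subset[OF _ finite_lookup[of v]]) auto
  thus ?thesis by (simp add: scaleR_poly_mapping_def)
qed

lemma lin_extend_superset:
  assumes "finite S" "Poly_Mapping.keys v \<subseteq> S"
  shows "lin_extend f v = (\<Sum>b\<in>S. Poly_Mapping.lookup v b *\<^sub>R f b)"
  unfolding lin_extend_def
  by (rule sum.mono_neutral_left) (use assms in \<open>auto simp: in_keys_iff\<close>)

lemma lin_extend_basis_vec [simp]: "lin_extend f (basis_vec b) = f b"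
  by (simp add: lin_extend_def basis_vec_def)

lemma linear_lin_extend: "linear (lin_extend f)"
proof (rule linearI)
  fix u v :: "'a \<Rightarrow>\<^sub>0 real"
  let ?S = "Poly_Mapping.keys u \<union> Poly_Mapping.keys v"
  have "lin_extend f (u + v) = (\<Sum>b\<in>?S. Poly_Mapping.lookup (u + v) b *\<^sub>R f b)"
    by (rule lin_extend_superset) (use Poly_Mapping.keys_add[of u v] in auto)
  also have "\<dots> = lin_extend f u + lin_extend f v"
    by (simp add: lin_extend_superset[of ?S u] lin_extend_superset[of ?S v]
        lookup_add scaleR_add_left sum.distrib)
  finally show "lin_extend f (u + v) = lin_extend f u + lin_extend f v" .
next
  fix r :: real and v :: "'a \<Rightarrow>\<^sub>0 real"
  have l: "Poly_Mapping.lookup (r *\<^sub>R v) b = r * Poly_Mapping.lookup v b" for b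
    by (rule lookup_scaleR_real)
  have "lin_extend f (r *\<^sub>R v)
      = (\<Sum>b\<in>Poly_Mapping.keys v. Poly_Mapping.lookup (r *\<^sub>R v) b *\<^sub>R f b)"
    by (rule lin_extend_superset) (auto simp: in_keys_iff l)
  also have "\<dots> = r *\<^sub>R lin_extend f v"
    by (simp add: lin_extend_def l scaleR_sum_right)
  finally show "lin_extend f (r *\<^sub>R v) = r *\<^sub>R lin_extend f v" .
qed

lemma lin_extend_unique:
  assumes "linear h" "\<And>b. h (basis_vec b) = f b"
  shows "h v = lin_extend f v"
proof -
  have "v = (\<Sum>b\<in>Poly_Mapping.keys v. Poly_Mapping.lookup v b *\<^sub>R basis_vec b)"
    by (rule poly_mapping_eqI)
      (auto simp: lookup_sum lookup_scaleR_real basis_vec_def lookup_single when_def in_keys_iff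
          if_distrib[of "\<lambda>x. _ * x"] cong: if_cong)
  hence "h v = h (\<Sum>b\<in>Poly_Mapping.keys v. Poly_Mapping.lookup v b *\<^sub>R basis_vec b)"
    by simp
  also have "\<dots> = lin_extend f v"
    using assms by (simp add: linear_sum linear_cmul lin_extend_def)
  finally show ?thesis .
qed

lemma linear_tensor_left: "linear (\<lambda>u. tensor u v)"
  unfolding tensor_def by (rule linear_lin_extend)

lemma linear_tensor_right: "linear (\<lambda>v. tensor u v)"
  unfolding tensor_def lin_extend_def[of _ u]
  by (intro linear_compose_sum linear_compose_scale_right ballI linear_lin_extend)

lemma tensor_map_tensor:
  assumes "linear f" "linear g"
  shows "tensor_map f g (tensor u v) = tensor (f u) (g v)"
proof -
  have *: "tensor_map f g (tensor (basis_vec b) v) = tensor (f (basis_vec b)) (g v)" for b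
  proof -
    have 1: "linear (\<lambda>v. tensor_map f g (tensor (basis_vec b) v))"
      using linear_compose[OF linear_tensor_right linear_lin_extend]
      by (simp add: tensor_map_def o_def)
    have 2: "linear (\<lambda>v. tensor (f (basis_vec b)) (g v))"
      using linear_compose[OF assms(2) linear_tensor_right] by (simp add: o_def)
    have 3: "tensor_map f g (tensor (basis_vec b) (basis_vec c))
        = tensor (f (basis_vec b)) (g (basis_vec c))" for c
      by (simp add: tensor_map_def tensor_def[of "basis_vec _"])
    show ?thesis
      by (rule trans[OF lin_extend_unique[OF 1 3] lin_extend_unique[OF 2 refl, symmetric]])
  qed
  have 1: "linear (\<lambda>u. tensor_map f g (tensor u v))"
    using linear_compose[OF linear_tensor_left linear_lin_extend]
    by (simp add: tensor_map_def o_def)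
  have 2: "linear (\<lambda>u. tensor (f u) (g v))"
    using linear_compose[OF assms(1) linear_tensor_left] by (simp add: o_def)
  show ?thesis
    by (rule trans[OF lin_extend_unique[OF 1 *] lin_extend_unique[OF 2 refl, symmetric]])
qed


section \<open>Submodular and modular functions\<close>

text \<open>
  A function on the subsets of \<open>I\<close> with values in \<open>\<real> \<union> {\<infinity>}\<close> is an extensional function on
  \<open>Pow I\<close> (equal to \<open>undefined\<close> elsewhere), so that equality of functions is equality on \<open>Pow I\<close>.
\<close>

definition submodular_funs :: "'a set \<Rightarrow> ('a set \<Rightarrow> ereal) set" where
  "submodular_funs I = {z \<in> Pow I \<rightarrow>\<^sub>E {x. x \<noteq> -\<infinity>}.
     z {} = 0 \<and> z I < \<infinity> \<and>
     (\<forall>A\<subseteq>I. \<forall>B\<subseteq>I. z (A \<union> B) + z (A \<inter> B) \<le> z A + z B)}"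

text \<open>
  Equality is required where the right-hand side is finite. Requiring it for infinite values as
  well would force \<open>z\<close> to be finite everywhere (take \<open>B = I - A\<close>), and the functions \<open>z\<^sup>P\<close> below
  would not be modular.
\<close>

definition modular_funs :: "'a set \<Rightarrow> ('a set \<Rightarrow> ereal) set" where
  "modular_funs I = {z \<in> submodular_funs I.
     \<forall>A\<subseteq>I. \<forall>B\<subseteq>I. z A < \<infinity> \<longrightarrow> z B < \<infinity> \<longrightarrow> z (A \<union> B) + z (A \<inter> B) = z A + z B}"

definition minor :: "('a set \<Rightarrow> ereal) \<Rightarrow> 'a set \<Rightarrow> 'a set \<Rightarrow> ('a set \<Rightarrow> ereal)" where
  "minor z A B = (\<lambda>U\<in>Pow (B - A). z (A \<union> U) - z A)"

definition product_fun ::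
  "'a set set \<Rightarrow> ('a set \<Rightarrow> 'a set \<Rightarrow> ereal) \<Rightarrow> ('a set \<Rightarrow> ereal)" where
  "product_fun \<C> u = (\<lambda>E\<in>Pow (\<Union>\<C>). \<Sum>C\<in>\<C>. u C (E \<inter> C))"

text \<open>\<open>z\<close> is a function on \<open>Pow (C1 \<union> C2)\<close>, with \<open>C1\<close> and \<open>C2\<close> disjoint.\<close>

definition decomposes :: "('a set \<Rightarrow> ereal) \<Rightarrow> 'a set \<Rightarrow> 'a set \<Rightarrow> bool" where
  "decomposes z C1 C2 \<longleftrightarrow> (\<forall>E\<subseteq>C1 \<union> C2. z E = z (E \<inter> C1) + z (E \<inter> C2))"


section \<open>Preorders\<close>

text \<open>A preorder on \<open>I\<close> is a relation \<open>P\<close> with \<open>preorder_on I P\<close>; \<open>(x, y) \<in> P\<close> means \<open>x \<le> y\<close>.\<close>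

definition down_set :: "'a set \<Rightarrow> 'a rel \<Rightarrow> 'a set \<Rightarrow> bool" where
  "down_set I P A \<longleftrightarrow> A \<subseteq> I \<and> (\<forall>y\<in>A. \<forall>x. (x, y) \<in> P \<longrightarrow> x \<in> A)"

definition convex_in :: "'a set \<Rightarrow> 'a rel \<Rightarrow> 'a set \<Rightarrow> bool" where
  "convex_in I P C \<longleftrightarrow> (\<exists>A B. down_set I P A \<and> down_set I P B \<and> A \<subseteq> B \<and> C = B - A)"

definition bubbles :: "'a set \<Rightarrow> 'a rel \<Rightarrow> 'a set set" where
  "bubbles I P = I // (P \<inter> P\<inverse>)"

definition disconnected :: "'a rel \<Rightarrow> 'a set \<Rightarrow> 'a set \<Rightarrow> bool" where
  "disconnected P C1 C2 \<longleftrightarrow> (\<forall>x\<in>C1. \<forall>y\<in>C2. (x, y) \<notin> P \<and> (y, x) \<notin> P)"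

definition totally_disconnected :: "'a set \<Rightarrow> 'a rel \<Rightarrow> bool" where
  "totally_disconnected I P \<longleftrightarrow> equiv I P"

definition compatible :: "'a set \<Rightarrow> 'a rel \<Rightarrow> ('a set \<Rightarrow> ereal) \<Rightarrow> bool" where
  "compatible I P z \<longleftrightarrow>
     (\<forall>A. down_set I P A \<longrightarrow> z A < \<infinity>) \<and>
     (\<forall>A B C1 C2. down_set I P A \<longrightarrow> down_set I P B \<longrightarrow> A \<subseteq> B \<longrightarrow>
        C1 \<union> C2 = B - A \<longrightarrow> C1 \<inter> C2 = {} \<longrightarrow> disconnected P C1 C2 \<longrightarrow>
        decomposes (minor z A B) C1 C2)"

text \<open>
  \<open>z\<^sub>C\<close> for a convex set \<open>C\<close>: any presentation \<open>C = B - A\<close> gives the same function when \<open>P\<close> is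
  compatible with \<open>z\<close>, see \<open>convex_minor_eq\<close>.
\<close>

definition convex_minor :: "'a set \<Rightarrow> 'a rel \<Rightarrow> ('a set \<Rightarrow> ereal) \<Rightarrow> 'a set \<Rightarrow> ('a set \<Rightarrow> ereal)" where
  "convex_minor I P z C =
     (let (A, B) = (SOME (A, B). down_set I P A \<and> down_set I P B \<and> A \<subseteq> B \<and> C = B - A)
      in minor z A B)"

definition conforms :: "'a set \<Rightarrow> 'a rel \<Rightarrow> ('a set \<Rightarrow> ereal) \<Rightarrow> bool" where
  "conforms I P z \<longleftrightarrow> compatible I P z \<and>
     (\<forall>C C1 C2. convex_in I P C \<longrightarrow> C1 \<union> C2 = C \<longrightarrow> C1 \<inter> C2 = {} \<longrightarrow>
        decomposes (convex_minor I P z C) C1 C2 \<longrightarrow> disconnected P C1 C2)"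

definition Pre :: "'a set \<Rightarrow> ('a set \<Rightarrow> ereal) \<Rightarrow> 'a rel set" where
  "Pre I z = {P. preorder_on I P \<and> conforms I P z}"

definition lower_fun :: "'a set \<Rightarrow> 'a rel \<Rightarrow> ('a set \<Rightarrow> ereal) \<Rightarrow> ('a set \<Rightarrow> ereal)" where  \<comment> \<open>\<open>z\<^sub>P\<close>\<close>
  "lower_fun I P z = product_fun (bubbles I P) (convex_minor I P z)"

definition upper_fun :: "'a set \<Rightarrow> 'a rel \<Rightarrow> ('a set \<Rightarrow> ereal) \<Rightarrow> ('a set \<Rightarrow> ereal)" where  \<comment> \<open>\<open>z\<^sup>P\<close>\<close>
  "upper_fun I P z = (\<lambda>A\<in>Pow I. if down_set I P A then z A else \<infinity>)"

text \<open>Existence and uniqueness are shown in \<open>pre_ex1\<close>.\<close>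

definition pre :: "'a set \<Rightarrow> ('a set \<Rightarrow> ereal) \<Rightarrow> 'a rel" where
  "pre I z = (THE P. preorder_on I P \<and> (\<forall>A\<subseteq>I. down_set I P A \<longleftrightarrow> z A < \<infinity>))"

lemma down_set_Int: "down_set I P A \<Longrightarrow> down_set I P B \<Longrightarrow> down_set I P (A \<inter> B)"
  by (auto simp: down_set_def)

lemma minor_eq_aux:
  assumes z: "z \<in> submodular_funs I" and P: "compatible I P z"
    and A: "down_set I P A" and B: "down_set I P B" and AB: "A \<subseteq> B"
    and A': "down_set I P A'" and B': "down_set I P B'" and AB': "A' \<subseteq> B'"
    and eq: "B - A = B' - A'" and sub: "A' \<subseteq> A"
  shows "minor z A B = minor z A' B'"
proof -
  have disc: "disconnected P (B - A) (A - A')"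
    unfolding disconnected_def
  proof (intro ballI conjI notI)
    fix x y assume x: "x \<in> B - A" and y: "y \<in> A - A'"
    show False if "(x, y) \<in> P" using that x y A by (auto simp: down_set_def)
    show False if "(y, x) \<in> P"
    proof -
      have "y \<in> B'" using that x eq B' by (auto simp: down_set_def)
      thus False using y eq by auto
    qed
  qed
  have "decomposes (minor z A' B) (B - A) (A - A')"
  proof -
    have "(B - A) \<union> (A - A') = B - A'" "(B - A) \<inter> (A - A') = {}" "A' \<subseteq> B" using AB sub by auto
    thus ?thesis using P A' B disc unfolding compatible_def by metis
  qed
  hence dec: "minor z A' B E = minor z A' B (E \<inter> (B - A)) + minor z A' B (E \<inter> (A - A'))"
    if "E \<subseteq> B - A'" for E using that AB sub by (auto simp: decomposes_def)
  have fin: "\<bar>z A\<bar> \<noteq> \<infinity>" "\<bar>z A'\<bar> \<noteq> \<infinity>"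
    using z P A A' by (auto simp: compatible_def submodular_funs_def down_set_def PiE_iff)
  have "z (A \<union> U) - z A = z (A' \<union> U) - z A'" if U: "U \<subseteq> B - A" for U
  proof -
    have e: "A' \<union> (U \<union> (A - A')) = A \<union> U" "A' \<union> A = A"
        "(U \<union> (A - A')) \<inter> (B - A) = U" "(U \<union> (A - A')) \<inter> (A - A') = A - A'"
      using U sub by auto
    have s: "U \<union> (A - A') \<subseteq> B - A'" "U \<subseteq> B - A'" "A - A' \<subseteq> B - A'" using U sub AB by auto
    have "z (A \<union> U) - z A' = (z (A' \<union> U) - z A') + (z A - z A')"
      using dec[OF s(1)] s by (simp add: minor_def e)
    moreover have "z (A \<union> U) \<noteq> -\<infinity>" "z (A' \<union> U) \<noteq> -\<infinity>"
      using z U A A' B by (auto simp: submodular_funs_def PiE_iff down_set_def subset_iff)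
    ultimately show ?thesis
      using fin by (cases "z A"; cases "z A'"; cases "z (A \<union> U)"; cases "z (A' \<union> U)") auto
  qed
  thus ?thesis unfolding minor_def using eq by (auto intro!: restrict_ext)
qed

lemma minor_eq:
  assumes z: "z \<in> submodular_funs I" and P: "compatible I P z"
    and A: "down_set I P A" and B: "down_set I P B" and AB: "A \<subseteq> B"
    and A': "down_set I P A'" and B': "down_set I P B'" and AB': "A' \<subseteq> B'"
    and eq: "B - A = B' - A'"
  shows "minor z A B = minor z A' B'"
proof -
  have e: "B - A = (B \<inter> B') - (A \<inter> A')" "B' - A' = (B \<inter> B') - (A \<inter> A')"
    using eq AB AB' by auto
  have "minor z A B = minor z (A \<inter> A') (B \<inter> B')"
    by (rule minor_eq_aux[OF z P A B AB]) (use A A' B B' AB AB' e in \<open>auto intro: down_set_Int\<close>)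
  moreover have "minor z A' B' = minor z (A \<inter> A') (B \<inter> B')"
    by (rule minor_eq_aux[OF z P A' B' AB']) (use A A' B B' AB AB' e in \<open>auto intro: down_set_Int\<close>)
  ultimately show ?thesis by simp
qed

lemma convex_minor_eq:
  assumes "z \<in> submodular_funs I" "compatible I P z" "down_set I P A" "down_set I P B" "A \<subseteq> B"
  shows "convex_minor I P z (B - A) = minor z A B"
proof -
  let ?Q = "\<lambda>(A', B'). down_set I P A' \<and> down_set I P B' \<and> A' \<subseteq> B' \<and> B - A = B' - A'"
  have "?Q (SOME p. ?Q p)" by (rule someI[of ?Q "(A, B)"]) (use assms in auto)
  then obtain A' B' where "(SOME p. ?Q p) = (A', B')" "?Q (A', B')"
    by (cases "SOME p. ?Q p") auto
  thus ?thesis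
    using minor_eq[OF assms, of A' B'] by (simp add: convex_minor_def)
qed

lemma pre_ex1:
  assumes "finite I" and z: "z \<in> submodular_funs I"
  shows "\<exists>!P. preorder_on I P \<and> (\<forall>A\<subseteq>I. down_set I P A \<longleftrightarrow> z A < \<infinity>)"
proof (rule ex_ex1I)
  let ?F = "{A. A \<subseteq> I \<and> z A < \<infinity>}"
  define P where "P = {(x, y) \<in> I \<times> I. \<forall>A\<in>?F. y \<in> A \<longrightarrow> x \<in> A}"
  have IF: "I \<in> ?F" and EF: "{} \<in> ?F" using z by (auto simp: submodular_funs_def)
  have UI: "A \<union> B \<in> ?F \<and> A \<inter> B \<in> ?F" if "A \<in> ?F" "B \<in> ?F" for A B
  proof -
    have "z (A \<union> B) + z (A \<inter> B) \<le> z A + z B" "z (A \<union> B) \<noteq> -\<infinity>" "z (A \<inter> B) \<noteq> -\<infinity>"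
      "A \<union> B \<subseteq> I" "A \<inter> B \<subseteq> I"
      using that z by (auto simp: submodular_funs_def PiE_iff)
    thus ?thesis using that
      by (cases "z A"; cases "z B"; cases "z (A \<union> B)"; cases "z (A \<inter> B)") auto
  qed
  have Int: "\<Inter>\<A> \<in> ?F" if "finite \<A>" "\<A> \<noteq> {}" "\<A> \<subseteq> ?F" for \<A>
    using that
  proof (induction \<A> rule: finite_ne_induct)
    case (insert A \<A>)
    hence "A \<in> ?F" "\<Inter>\<A> \<in> ?F" by auto
    from UI[OF this] show ?case by simp
  qed auto
  have Un: "\<Union>\<A> \<in> ?F" if "finite \<A>" "\<A> \<subseteq> ?F" for \<A>
    using that
  proof (induction \<A> rule: finite_induct)
    case (insert A \<A>)
    hence "A \<in> ?F" "\<Union>\<A> \<in> ?F" by auto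
    from UI[OF this] show ?case by simp
  qed (use EF in auto)
  have finF: "finite ?F" using assms(1) by simp
  have "preorder_on I P"
    by (auto simp: preorder_on_def P_def refl_on_def trans_def)
  moreover have "down_set I P A \<longleftrightarrow> z A < \<infinity>" if AI: "A \<subseteq> I" for A
  proof
    assume "z A < \<infinity>"
    thus "down_set I P A" using AI by (auto simp: down_set_def P_def)
  next
    assume D: "down_set I P A"
    define m where "m y = \<Inter>{B \<in> ?F. y \<in> B}" for y
    have mF: "m y \<in> ?F" if "y \<in> A" for y
    proof -
      have "finite {B \<in> ?F. y \<in> B}" by (rule finite_subset[OF _ finF]) auto
      moreover have "I \<in> {B \<in> ?F. y \<in> B}" using IF AI that by auto
      ultimately show ?thesis unfolding m_def by (intro Int) blast+
    qed
    have "m y \<subseteq> A" if "y \<in> A" for y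
    proof
      fix x assume x: "x \<in> m y"
      have "x \<in> I" using x IF AI that unfolding m_def by blast
      hence "(x, y) \<in> P" using x that AI unfolding P_def m_def by blast
      thus "x \<in> A" using D that by (auto simp: down_set_def)
    qed
    moreover have "y \<in> m y" for y by (auto simp: m_def)
    ultimately have "A = \<Union>(m ` A)" by blast
    moreover have "\<Union>(m ` A) \<in> ?F"
      by (rule Un) (use mF AI assms(1) in \<open>auto intro: finite_subset\<close>)
    ultimately show "z A < \<infinity>" by auto
  qed
  ultimately show "\<exists>P. preorder_on I P \<and> (\<forall>A\<subseteq>I. down_set I P A \<longleftrightarrow> z A < \<infinity>)" by blast
next
  have sub: "P \<subseteq> Q" if P: "preorder_on I P" and Q: "preorder_on I Q"
    and D: "\<And>A. A \<subseteq> I \<Longrightarrow> down_set I Q A \<Longrightarrow> down_set I P A" for P Q :: "'a rel"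
  proof
    fix p assume "p \<in> P"
    then obtain x y where p: "p = (x, y)" "(x, y) \<in> P" "x \<in> I" "y \<in> I"
      using P by (cases p) (auto simp: preorder_on_def)
    let ?A = "{w. (w, y) \<in> Q}"
    have "?A \<subseteq> I" using Q by (auto simp: preorder_on_def)
    moreover from this have "down_set I Q ?A"
      using Q unfolding down_set_def preorder_on_def trans_def by blast
    ultimately have "down_set I P ?A" using D by blast
    moreover have "y \<in> ?A" using Q p by (auto simp: preorder_on_def refl_on_def)
    ultimately show "p \<in> Q" using p by (auto simp: down_set_def)
  qed
  fix P Q
  assume "preorder_on I P \<and> (\<forall>A\<subseteq>I. down_set I P A \<longleftrightarrow> z A < \<infinity>)"
    and "preorder_on I Q \<and> (\<forall>A\<subseteq>I. down_set I Q A \<longleftrightarrow> z A < \<infinity>)"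
  thus "P = Q" using sub[of P Q] sub[of Q P] by blast
qed


section \<open>The coproducts and the counit\<close>

definition SM :: "'a set \<Rightarrow> (('a set \<Rightarrow> ereal) \<Rightarrow>\<^sub>0 real) set" where
  "SM I = free_space (submodular_funs I)"

definition MOD :: "'a set \<Rightarrow> (('a set \<Rightarrow> ereal) \<Rightarrow>\<^sub>0 real) set" where
  "MOD I = free_space (modular_funs I)"

definition delta_SM :: "'a set \<Rightarrow> (('a set \<Rightarrow> ereal) \<Rightarrow>\<^sub>0 real)
    \<Rightarrow> (('a set \<Rightarrow> ereal) \<times> ('a set \<Rightarrow> ereal) \<Rightarrow>\<^sub>0 real)" where
  "delta_SM I = restrict
     (lin_extend (\<lambda>z. \<Sum>Q\<in>Pre I z.
        tensor (basis_vec (lower_fun I Q z)) (basis_vec (upper_fun I Q z))))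
     (SM I)"

definition delta_MOD :: "'a set \<Rightarrow> (('a set \<Rightarrow> ereal) \<Rightarrow>\<^sub>0 real)
    \<Rightarrow> (('a set \<Rightarrow> ereal) \<times> ('a set \<Rightarrow> ereal) \<Rightarrow>\<^sub>0 real)" where
  "delta_MOD I = restrict (delta_SM I) (MOD I)"

definition eps_MOD :: "'a set \<Rightarrow> (('a set \<Rightarrow> ereal) \<Rightarrow>\<^sub>0 real) \<Rightarrow> real" where
  "eps_MOD I = restrict
     (lin_extend (\<lambda>z. if totally_disconnected I (pre I z) then 1 else 0)) (MOD I)"

end

theory Submission
  imports Defs
begin

text \<open>
  Geometrically, \<open>z\<close> is the support function of a generalised permutohedron, the preorders
  conforming to \<open>z\<close> are the normal cones of its faces, \<open>z\<^sub>Q\<close> is the face belonging to \<open>Q\<close> and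
  \<open>z\<^sup>Q\<close> the affine cone at that face. Coassociativity says that a face \<open>P\<close> of a face \<open>Q\<close> is the
  same thing as a face \<open>R\<close> together with a face \<open>Q\<close> of the cone at \<open>R\<close>; the counit law says
  that exactly one face is the whole polytope. The proof is a combinatorial form of this picture.

  A preorder is determined by the lattice \<open>L\<close> of its down-sets. The set of all \<open>A\<close> at which
  \<open>x(A) \<le> z A\<close> is tight, for a point \<open>x\<close> in general position on a face, has a characterisation
  without \<open>x\<close>: the function \<open>z\<close> is finite on \<open>L\<close>, the sets \<open>{}\<close> and \<open>I\<close> belong to \<open>L\<close>, and two
  subsets \<open>X\<close>, \<open>Y\<close> lie in \<open>L\<close> if and only if \<open>X \<inter> Y\<close> and \<open>X \<union> Y\<close> do and
  \<open>z X + z Y = z (X \<inter> Y) + z (X \<union> Y)\<close>. By \<open>Pre_iff_tight_lattice\<close> a preorder conforms to \<open>z\<close>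
  exactly when its down-sets form such a tight lattice. In this language faces of the cone are
  immediate: \<open>Q\<close> conforms to \<open>z\<^sup>R\<close> if and only if it conforms to \<open>z\<close> and every down-set of \<open>Q\<close> is
  one of \<open>R\<close> (\<open>Pre_upper_iff\<close>).

  Faces of \<open>w = z\<^sub>Q\<close> rest on the inequality \<open>w A \<le> z A\<close>, that is, on the inclusion of the face in
  the polytope. If \<open>K\<close> is a tight lattice of \<open>w\<close>, then \<open>L = {A \<in> K. z A = w A}\<close> is one of \<open>z\<close>: for
  \<open>X\<close>, \<open>Y\<close> in \<open>L\<close> or for \<open>X \<inter> Y\<close>, \<open>X \<union> Y\<close> in \<open>L\<close>, the submodular inequalities of \<open>z\<close> and \<open>w\<close>
  squeeze all the terms (\<open>tight_lattice_below\<close>). Conversely \<open>K\<close> can be read off from \<open>L\<close> one bubble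
  at a time: \<open>E\<close> lies in \<open>K\<close> if and only if \<open>A \<union> (E \<inter> C) \<in> L\<close> whenever \<open>C\<close> is a bubble of \<open>Q\<close>
  and both \<open>A\<close> and the disjoint union \<open>A \<union> C\<close> are down-sets of \<open>Q\<close>. On preorders this operation
  is \<open>R \<mapsto> R \<inter> Q \<inter> Q\<inverse>\<close>. The two operations are mutually inverse, the functions attached to
  corresponding pairs agree (\<open>lower_lower\<close>, \<open>lower_upper\<close>, \<open>upper_upper\<close>), and coassociativity
  is the resulting change of summation index (\<open>sum_Pre_Pre_lower\<close>).

  For the counit, the only equivalence relation that conforms to \<open>z\<close> has as down-sets the sets \<open>A\<close>
  with \<open>z A + z (I - A) = z I\<close>; its bubbles are the connected components of \<open>z\<close>, so \<open>z\<^sub>Q = z\<close>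
  for this \<open>Q\<close>.
\<close>

section \<open>Conforming preorders as tight lattices\<close>

lemma submodular_not_MInfty: "z \<in> submodular_funs I \<Longrightarrow> A \<subseteq> I \<Longrightarrow> z A \<noteq> -\<infinity>"
  by (auto simp: submodular_funs_def PiE_iff)

lemma submodular_empty: "z \<in> submodular_funs I \<Longrightarrow> z {} = 0"
  by (simp add: submodular_funs_def)

lemma submodular_top: "z \<in> submodular_funs I \<Longrightarrow> z I < \<infinity>"
  by (simp add: submodular_funs_def)

lemma submodular_ineq:
  "z \<in> submodular_funs I \<Longrightarrow> A \<subseteq> I \<Longrightarrow> B \<subseteq> I \<Longrightarrow> z (A \<union> B) + z (A \<inter> B) \<le> z A + z B"
  by (simp add: submodular_funs_def)

lemma submodular_realE:
  assumes "z \<in> submodular_funs I" "A \<subseteq> I" "z A < \<infinity>"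
  obtains r where "z A = ereal r"
  using submodular_not_MInfty[OF assms(1,2)] assms(3) by (cases "z A") auto

text \<open>
  A decomposition of a minor is a condition on all its subsets, but the single equation for the
  whole set suffices: it forces equality in the submodular inequalities that compare
  \<open>A \<union> E\<close> with its parts in \<open>C1\<close> and \<open>C2\<close>.
\<close>
lemma decomposes_minor_iff:
  assumes z: "z \<in> submodular_funs I" and B: "A \<subseteq> B" "B \<subseteq> I" and fin: "z A < \<infinity>" "z B < \<infinity>"
    and C: "C1 \<union> C2 = B - A" "C1 \<inter> C2 = {}"
  shows "decomposes (minor z A B) C1 C2 \<longleftrightarrow> z (A \<union> C1) + z (A \<union> C2) = z A + z B"
proof -
  obtain a b where ab: "z A = ereal a" "z B = ereal b"
    using submodular_realE[OF z] B fin by (metis subset_trans)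
  have nm: "z (A \<union> U) \<noteq> -\<infinity>" if "U \<subseteq> B - A" for U
    using submodular_not_MInfty[OF z, of "A \<union> U"] that B by auto
  show ?thesis
  proof
    assume "decomposes (minor z A B) C1 C2"
    hence "minor z A B (B - A) = minor z A B ((B - A) \<inter> C1) + minor z A B ((B - A) \<inter> C2)"
      using C(1) unfolding decomposes_def by blast
    moreover have "(B - A) \<inter> C1 = C1" "(B - A) \<inter> C2 = C2" "C1 \<subseteq> B - A" "C2 \<subseteq> B - A"
      "A \<union> (B - A) = B" using C(1) B by blast+
    ultimately have "z B - z A = (z (A \<union> C1) - z A) + (z (A \<union> C2) - z A)"
      by (simp add: minor_def)
    moreover have "z (A \<union> C1) \<noteq> -\<infinity>" "z (A \<union> C2) \<noteq> -\<infinity>" using nm C(1) by blast+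
    ultimately show "z (A \<union> C1) + z (A \<union> C2) = z A + z B"
      unfolding ab by (cases "z (A \<union> C1)"; cases "z (A \<union> C2)") simp_all
  next
    assume eq: "z (A \<union> C1) + z (A \<union> C2) = z A + z B"
    have "z (A \<union> C1) \<noteq> -\<infinity>" "z (A \<union> C2) \<noteq> -\<infinity>" using nm C(1) by blast+
    then obtain c1 c2 where c: "z (A \<union> C1) = ereal c1" "z (A \<union> C2) = ereal c2"
      using eq unfolding ab by (cases "z (A \<union> C1)"; cases "z (A \<union> C2)") simp_all
    show "decomposes (minor z A B) C1 C2"
      unfolding decomposes_def
    proof (intro allI impI)
      fix E assume E: "E \<subseteq> C1 \<union> C2"
      let ?E1 = "A \<union> (E \<inter> C1)" and ?E2 = "A \<union> (E \<inter> C2)"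
      have s: "A \<union> C1 \<subseteq> I" "A \<union> C2 \<subseteq> I" "A \<union> E \<subseteq> I" "?E1 \<subseteq> I" "?E2 \<subseteq> I"
          "(A \<union> E) \<union> (A \<union> C1) \<subseteq> I"
        using C(1) B E by blast+
      (* The first inequality is one half of the claim; the sum of the other two, with c1 + c2
         replaced by z A + z B, is the other half. *)
      have "z (?E1 \<union> ?E2) + z (?E1 \<inter> ?E2) \<le> z ?E1 + z ?E2"
        using submodular_ineq[OF z] s by blast
      moreover have "?E1 \<union> ?E2 = A \<union> E" "?E1 \<inter> ?E2 = A" using C E by blast+
      ultimately have 1: "z (A \<union> E) + z A \<le> z ?E1 + z ?E2" by simp
      have "z ((A \<union> E) \<union> (A \<union> C1)) + z ((A \<union> E) \<inter> (A \<union> C1)) \<le> z (A \<union> E) + z (A \<union> C1)"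
        using submodular_ineq[OF z] s by blast
      moreover have "(A \<union> E) \<inter> (A \<union> C1) = ?E1" by auto
      ultimately have 2: "z ((A \<union> E) \<union> (A \<union> C1)) + z ?E1 \<le> z (A \<union> E) + z (A \<union> C1)" by simp
      have "z (((A \<union> E) \<union> (A \<union> C1)) \<union> (A \<union> C2)) + z (((A \<union> E) \<union> (A \<union> C1)) \<inter> (A \<union> C2))
          \<le> z ((A \<union> E) \<union> (A \<union> C1)) + z (A \<union> C2)"
        using submodular_ineq[OF z] s by blast
      moreover have "((A \<union> E) \<union> (A \<union> C1)) \<union> (A \<union> C2) = B"
          "((A \<union> E) \<union> (A \<union> C1)) \<inter> (A \<union> C2) = ?E2"
        using C E B by blast+
      ultimately have 3: "z B + z ?E2 \<le> z ((A \<union> E) \<union> (A \<union> C1)) + z (A \<union> C2)" by simp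
      have "z (A \<union> E) - z A = (z ?E1 - z A) + (z ?E2 - z A)"
        using 1 2 3 eq submodular_not_MInfty[OF z s(3)] submodular_not_MInfty[OF z s(4)]
          submodular_not_MInfty[OF z s(5)] submodular_not_MInfty[OF z s(6)]
        unfolding c ab
        by (cases "z (A \<union> E)"; cases "z ?E1"; cases "z ?E2"; cases "z ((A \<union> E) \<union> (A \<union> C1))")
          simp_all
      moreover have "E \<subseteq> B - A" "E \<inter> C1 \<subseteq> B - A" "E \<inter> C2 \<subseteq> B - A" using E C(1) by blast+
      ultimately show "minor z A B E = minor z A B (E \<inter> C1) + minor z A B (E \<inter> C2)"
        by (simp add: minor_def)
    qed
  qed
qed

definition down_sets :: "'a set \<Rightarrow> 'a rel \<Rightarrow> 'a set set" where
  "down_sets I P = {A. down_set I P A}"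

text \<open>The sets on which all points of a face are tight, described without points.\<close>
definition tight_lattice :: "'a set \<Rightarrow> ('a set \<Rightarrow> ereal) \<Rightarrow> 'a set set \<Rightarrow> bool" where
  "tight_lattice I z L \<longleftrightarrow> L \<subseteq> Pow I \<and> {} \<in> L \<and> I \<in> L \<and> (\<forall>X\<in>L. z X < \<infinity>) \<and>
     (\<forall>X\<subseteq>I. \<forall>Y\<subseteq>I. X \<in> L \<and> Y \<in> L \<longleftrightarrow>
        X \<inter> Y \<in> L \<and> X \<union> Y \<in> L \<and> z X + z Y = z (X \<inter> Y) + z (X \<union> Y))"

lemma tight_latticeI:
  assumes "L \<subseteq> Pow I" "{} \<in> L" "I \<in> L" "\<And>X. X \<in> L \<Longrightarrow> z X < \<infinity>"
    and "\<And>X Y. X \<in> L \<Longrightarrow> Y \<in> L \<Longrightarrow>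
           X \<inter> Y \<in> L \<and> X \<union> Y \<in> L \<and> z X + z Y = z (X \<inter> Y) + z (X \<union> Y)"
    and "\<And>X Y. X \<subseteq> I \<Longrightarrow> Y \<subseteq> I \<Longrightarrow> X \<inter> Y \<in> L \<Longrightarrow> X \<union> Y \<in> L \<Longrightarrow>
           z X + z Y = z (X \<inter> Y) + z (X \<union> Y) \<Longrightarrow> X \<in> L \<and> Y \<in> L"
  shows "tight_lattice I z L"
proof -
  have "X \<in> L \<and> Y \<in> L \<longleftrightarrow> X \<inter> Y \<in> L \<and> X \<union> Y \<in> L \<and> z X + z Y = z (X \<inter> Y) + z (X \<union> Y)"
    if "X \<subseteq> I" "Y \<subseteq> I" for X Y
    using assms(5)[of X Y] assms(6)[OF that] by argo
  thus ?thesis unfolding tight_lattice_def using assms(1-4) by simp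
qed

lemma tight_latticeD:
  assumes "tight_lattice I z L"
  shows "L \<subseteq> Pow I" "{} \<in> L" "I \<in> L" "X \<in> L \<Longrightarrow> z X < \<infinity>"
    and "X \<in> L \<Longrightarrow> Y \<in> L \<Longrightarrow> X \<inter> Y \<in> L"
    and "X \<in> L \<Longrightarrow> Y \<in> L \<Longrightarrow> X \<union> Y \<in> L"
    and "X \<in> L \<Longrightarrow> Y \<in> L \<Longrightarrow> z X + z Y = z (X \<inter> Y) + z (X \<union> Y)"
    and "X \<subseteq> I \<Longrightarrow> Y \<subseteq> I \<Longrightarrow> X \<inter> Y \<in> L \<Longrightarrow> X \<union> Y \<in> L \<Longrightarrow>
           z X + z Y = z (X \<inter> Y) + z (X \<union> Y) \<Longrightarrow> X \<in> L \<and> Y \<in> L"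
proof -
  note D = assms[unfolded tight_lattice_def]
  show L: "L \<subseteq> Pow I" "{} \<in> L" "I \<in> L" "X \<in> L \<Longrightarrow> z X < \<infinity>" using D by simp_all
  have iff: "X \<in> L \<and> Y \<in> L \<longleftrightarrow>
      X \<inter> Y \<in> L \<and> X \<union> Y \<in> L \<and> z X + z Y = z (X \<inter> Y) + z (X \<union> Y)"
    if "X \<subseteq> I" "Y \<subseteq> I" using D that by simp
  have sub: "X \<in> L \<Longrightarrow> X \<subseteq> I" for X using L(1) by auto
  show "X \<in> L \<Longrightarrow> Y \<in> L \<Longrightarrow> X \<inter> Y \<in> L" "X \<in> L \<Longrightarrow> Y \<in> L \<Longrightarrow> X \<union> Y \<in> L"
    "X \<in> L \<Longrightarrow> Y \<in> L \<Longrightarrow> z X + z Y = z (X \<inter> Y) + z (X \<union> Y)"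
    using iff sub[of X] sub[of Y] by argo+
  show "X \<subseteq> I \<Longrightarrow> Y \<subseteq> I \<Longrightarrow> X \<inter> Y \<in> L \<Longrightarrow> X \<union> Y \<in> L \<Longrightarrow>
      z X + z Y = z (X \<inter> Y) + z (X \<union> Y) \<Longrightarrow> X \<in> L \<and> Y \<in> L" using iff by argo
qed

lemma down_set_Un: "down_set I P A \<Longrightarrow> down_set I P B \<Longrightarrow> down_set I P (A \<union> B)"
  by (auto simp: down_set_def)

lemma down_set_top: "preorder_on I P \<Longrightarrow> down_set I P I"
  by (auto simp: down_set_def preorder_on_def)

text \<open>This turns the two clauses about disconnected unions into closure properties of down-sets.\<close>
lemma disconnected_iff_down_sets:
  assumes "down_set I P A" "down_set I P B" "A \<subseteq> B" "C1 \<union> C2 = B - A" "C1 \<inter> C2 = {}"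
  shows "disconnected P C1 C2 \<longleftrightarrow> down_set I P (A \<union> C1) \<and> down_set I P (A \<union> C2)"
proof
  assume "disconnected P C1 C2"
  thus "down_set I P (A \<union> C1) \<and> down_set I P (A \<union> C2)"
    using assms unfolding disconnected_def down_set_def by blast
next
  assume "down_set I P (A \<union> C1) \<and> down_set I P (A \<union> C2)"
  hence D: "down_set I P (A \<union> C1)" "down_set I P (A \<union> C2)" by auto
  show "disconnected P C1 C2"
    unfolding disconnected_def
  proof (intro ballI conjI notI)
    fix x y assume xy: "x \<in> C1" "y \<in> C2"
    hence "x \<notin> A \<union> C2" "y \<notin> A \<union> C1" using assms(4,5) by blast+
    thus "(x, y) \<in> P \<Longrightarrow> False" "(y, x) \<in> P \<Longrightarrow> False"
      using D xy unfolding down_set_def by blast+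
  qed
qed

text \<open>
  Two incomparable down-sets \<open>X\<close> and \<open>Y\<close> present the convex set \<open>(X \<union> Y) - (X \<inter> Y)\<close> as the
  disconnected union of \<open>X - Y\<close> and \<open>Y - X\<close>, and every disconnected union of a convex set arises in
  this way. Compatibility is therefore one direction of the tightness equivalence, and conformity
  is the other.
\<close>
lemma Pre_iff_tight_lattice:
  assumes z: "z \<in> submodular_funs I" and P: "preorder_on I P"
  shows "P \<in> Pre I z \<longleftrightarrow> tight_lattice I z (down_sets I P)"
proof
  assume "P \<in> Pre I z"
  hence cf: "conforms I P z" and cp: "compatible I P z" by (auto simp: Pre_def conforms_def)
  have fin: "z A < \<infinity>" if "down_set I P A" for A using cp that by (auto simp: compatible_def)
  show "tight_lattice I z (down_sets I P)"
  proof (rule tight_latticeI)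
    fix X Y assume "X \<in> down_sets I P" "Y \<in> down_sets I P"
    hence X: "down_set I P X" and Y: "down_set I P Y" by (auto simp: down_sets_def)
    have IU: "down_set I P (X \<inter> Y)" "down_set I P (X \<union> Y)"
      using X Y by (auto intro: down_set_Int down_set_Un)
    have C: "(X - Y) \<union> (Y - X) = (X \<union> Y) - (X \<inter> Y)" "(X - Y) \<inter> (Y - X) = {}" by auto
    have e: "X \<inter> Y \<union> (X - Y) = X" "X \<inter> Y \<union> (Y - X) = Y" by auto
    have "disconnected P (X - Y) (Y - X)"
      using disconnected_iff_down_sets[OF IU _ C] X Y unfolding e by blast
    hence "decomposes (minor z (X \<inter> Y) (X \<union> Y)) (X - Y) (Y - X)"
      using cp C IU unfolding compatible_def by blast
    hence "z X + z Y = z (X \<inter> Y) + z (X \<union> Y)"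
      using decomposes_minor_iff[OF z _ _ fin[OF IU(1)] fin[OF IU(2)] C] X Y
      unfolding e down_set_def by blast
    thus "X \<inter> Y \<in> down_sets I P \<and> X \<union> Y \<in> down_sets I P \<and>
        z X + z Y = z (X \<inter> Y) + z (X \<union> Y)" using IU by (simp add: down_sets_def)
  next
    fix X Y assume XY: "X \<subseteq> I" "Y \<subseteq> I" "X \<inter> Y \<in> down_sets I P" "X \<union> Y \<in> down_sets I P"
      and eq: "z X + z Y = z (X \<inter> Y) + z (X \<union> Y)"
    hence IU: "down_set I P (X \<inter> Y)" "down_set I P (X \<union> Y)" by (auto simp: down_sets_def)
    have C: "(X - Y) \<union> (Y - X) = (X \<union> Y) - (X \<inter> Y)" "(X - Y) \<inter> (Y - X) = {}" by auto
    have e: "X \<inter> Y \<union> (X - Y) = X" "X \<inter> Y \<union> (Y - X) = Y" by auto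
    have "decomposes (minor z (X \<inter> Y) (X \<union> Y)) (X - Y) (Y - X)"
      using decomposes_minor_iff[OF z _ _ fin[OF IU(1)] fin[OF IU(2)] C] XY eq
      unfolding e by blast
    hence "decomposes (convex_minor I P z ((X \<union> Y) - (X \<inter> Y))) (X - Y) (Y - X)"
      using convex_minor_eq[OF z cp IU] by (metis Int_lower1 Un_upper1 subset_trans)
    moreover have "convex_in I P ((X \<union> Y) - (X \<inter> Y))"
      unfolding convex_in_def using IU by blast
    ultimately have "disconnected P (X - Y) (Y - X)"
      using cf C unfolding conforms_def by blast
    thus "X \<in> down_sets I P \<and> Y \<in> down_sets I P"
      using disconnected_iff_down_sets[OF IU _ C] unfolding e down_sets_def by blast
  qed (use fin P in \<open>auto simp: down_sets_def down_set_def preorder_on_def\<close>)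
next
  assume T: "tight_lattice I z (down_sets I P)"
  have fin: "z A < \<infinity>" if "down_set I P A" for A
    using tight_latticeD(4)[OF T] that by (auto simp: down_sets_def)
  have split: "decomposes (minor z A B) C1 C2 \<longleftrightarrow> disconnected P C1 C2"
    if A: "down_set I P A" and B: "down_set I P B" and AB: "A \<subseteq> B"
      and C: "C1 \<union> C2 = B - A" "C1 \<inter> C2 = {}" for A B C1 C2
  proof -
    have e: "(A \<union> C1) \<inter> (A \<union> C2) = A" "(A \<union> C1) \<union> (A \<union> C2) = B" using C AB by auto
    have s: "A \<union> C1 \<subseteq> I" "A \<union> C2 \<subseteq> I" "B \<subseteq> I" using A B C by (auto simp: down_set_def)
    have "down_set I P (A \<union> C1) \<and> down_set I P (A \<union> C2) \<longleftrightarrow>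
        z (A \<union> C1) + z (A \<union> C2) = z A + z B"
      using tight_latticeD(7)[OF T, of "A \<union> C1" "A \<union> C2"]
        tight_latticeD(8)[OF T, of "A \<union> C1" "A \<union> C2"] s A B
      unfolding e down_sets_def by blast
    thus ?thesis
      using decomposes_minor_iff[OF z AB s(3) fin[OF A] fin[OF B] C]
        disconnected_iff_down_sets[OF A B AB C] by blast
  qed
  have cp: "compatible I P z" unfolding compatible_def using fin split by blast
  have "disconnected P C1 C2"
    if C: "convex_in I P C" "C1 \<union> C2 = C" "C1 \<inter> C2 = {}"
      and d: "decomposes (convex_minor I P z C) C1 C2" for C C1 C2
  proof -
    obtain A B where AB: "down_set I P A" "down_set I P B" "A \<subseteq> B" "C = B - A"
      using C by (auto simp: convex_in_def)
    thus ?thesis using convex_minor_eq[OF z cp AB(1-3)] split[OF AB(1-3)] C d by auto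
  qed
  thus "P \<in> Pre I z" using cp P by (auto simp: Pre_def conforms_def)
qed

section \<open>Bubbles and down-sets\<close>

lemma sum_not_MInfty:
  fixes f :: "'b \<Rightarrow> ereal"
  assumes "\<And>x. x \<in> S \<Longrightarrow> f x \<noteq> -\<infinity>"
  shows "sum f S \<noteq> -\<infinity>"
  using assms by (induction S rule: infinite_finite_induct) simp_all

lemma equiv_bubbles: "preorder_on I Q \<Longrightarrow> equiv I (Q \<inter> Q\<inverse>)"
proof -
  assume A: "preorder_on I Q"
  have 1: "refl_on I (Q \<inter> Q\<inverse>)" using A by (simp add: preorder_on_def refl_on_def)
  have 3: "Q \<inter> Q\<inverse> \<subseteq> I \<times> I" using A by (auto simp add: preorder_on_def)
  have 2: "trans (Q \<inter> Q\<inverse>)"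
    using A by (intro trans_Int) (simp_all add: preorder_on_def)
  show "equiv I (Q \<inter> Q\<inverse>)" unfolding equiv_def using 1 2 3 by (simp add: sym_Int_converse)
qed

lemma Union_bubbles: "preorder_on I Q \<Longrightarrow> \<Union>(bubbles I Q) = I"
  unfolding bubbles_def by (rule Union_quotient[OF equiv_bubbles])

lemma bubbles_disjoint:
  "preorder_on I Q \<Longrightarrow> C \<in> bubbles I Q \<Longrightarrow> D \<in> bubbles I Q \<Longrightarrow> C = D \<or> C \<inter> D = {}"
  unfolding bubbles_def  by (rule quotient_disj[OF equiv_bubbles])

lemma finite_bubbles: "finite I \<Longrightarrow> finite (bubbles I Q)"
  by (simp add: bubbles_def quotient_def)

lemma bubble_related:
  assumes "preorder_on I Q" "C \<in> bubbles I Q" "x \<in> C"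
  shows "y \<in> C \<longleftrightarrow> (x, y) \<in> Q \<and> (y, x) \<in> Q"
proof -
  note E = equiv_bubbles[OF assms(1)] and C = assms(2)[unfolded bubbles_def]
  have "(x, y) \<in> Q \<inter> Q\<inverse>" if "y \<in> C"
    using quotient_eq_iff[OF E C C assms(3) that] by simp
  moreover have "y \<in> C" if "(x, y) \<in> Q \<inter> Q\<inverse>"
    using in_quotient_imp_closed[OF E C assms(3) that] .
  ultimately show ?thesis by blast
qed

lemma bubble_of_elem:
  assumes "preorder_on I Q" "x \<in> I"
  obtains C where "C \<in> bubbles I Q" "x \<in> C"
  using Union_bubbles[OF assms(1)] assms(2) by blast

lemma bubble_subset:
  assumes "preorder_on I Q" "C \<in> bubbles I Q"
  shows "C \<subseteq> I"
  using Union_bubbles[OF assms(1)] assms(2) by blast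

text \<open>The unions of bubbles.\<close>
definition saturated :: "'a set \<Rightarrow> 'a rel \<Rightarrow> 'a set \<Rightarrow> bool" where
  "saturated I Q D \<longleftrightarrow> D \<subseteq> I \<and> (\<forall>C\<in>bubbles I Q. C \<subseteq> D \<or> C \<inter> D = {})"

lemma saturated_bubble:
  assumes "preorder_on I Q" "C \<in> bubbles I Q"
  shows "saturated I Q C"
  unfolding saturated_def
  using bubbles_disjoint[OF assms(1) _ assms(2)] bubble_subset[OF assms] by blast

lemma saturated_down_set:
  assumes "preorder_on I Q" "down_set I Q A"
  shows "saturated I Q A"
  unfolding saturated_def
proof (intro conjI ballI)
  show "A \<subseteq> I" using assms(2) by (simp add: down_set_def)
  fix C assume C: "C \<in> bubbles I Q"
  have "y \<in> A" if "x \<in> C" "x \<in> A" "y \<in> C" for x y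
    using bubble_related[OF assms(1) C that(1), of y] that assms(2) by (simp add: down_set_def)
  thus "C \<subseteq> A \<or> C \<inter> A = {}" by blast
qed

text \<open>
  One step in a maximal chain of down-sets. Each such step presents the bubble \<open>C\<close> as the convex set
  \<open>(A \<union> C) - A\<close>.
\<close>
definition adds_bubble :: "'a set \<Rightarrow> 'a rel \<Rightarrow> 'a set \<Rightarrow> 'a set \<Rightarrow> bool" where
  "adds_bubble I Q A C \<longleftrightarrow>
     down_set I Q A \<and> C \<in> bubbles I Q \<and> A \<inter> C = {} \<and> down_set I Q (A \<union> C)"

lemma adds_bubbleD:
  assumes "adds_bubble I Q A C"
  shows "down_set I Q A" "C \<in> bubbles I Q" "A \<inter> C = {}" "down_set I Q (A \<union> C)" "A \<subseteq> I" "C \<subseteq> I"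
  using assms unfolding adds_bubble_def down_set_def by blast+

text \<open>For \<open>A\<close> take everything strictly below the bubble.\<close>
lemma bubble_added:
  assumes Q: "preorder_on I Q" and C: "C \<in> bubbles I Q"
  obtains A where "adds_bubble I Q A C"
proof
  let ?B = "{x. \<exists>y\<in>C. (x, y) \<in> Q}"
  have tr: "(x, y) \<in> Q \<Longrightarrow> (y, v) \<in> Q \<Longrightarrow> (x, v) \<in> Q" for x y v
    using Q by (auto simp: preorder_on_def trans_def)
  have QI: "(x, y) \<in> Q \<Longrightarrow> x \<in> I" for x y using Q by (auto simp: preorder_on_def)
  have CB: "C \<subseteq> ?B" using bubble_related[OF Q C] by blast
  have 1: "down_set I Q ?B" unfolding down_set_def using tr QI by blast
  have "down_set I Q (?B - C)"
    unfolding down_set_def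
  proof (intro conjI ballI allI impI)
    show "?B - C \<subseteq> I" using QI by blast
    fix y x assume y: "y \<in> ?B - C" and xy: "(x, y) \<in> Q"
    obtain v where v: "v \<in> C" "(y, v) \<in> Q" using y by blast
    have "x \<notin> C"
    proof
      assume x: "x \<in> C"
      hence "(v, x) \<in> Q" using bubble_related[OF Q C v(1)] by blast
      hence "(v, y) \<in> Q" using xy tr by blast
      thus False using bubble_related[OF Q C v(1)] v(2) y by blast
    qed
    thus "x \<in> ?B - C" using xy v tr by blast
  qed
  moreover have "(?B - C) \<union> C = ?B" using CB by blast
  ultimately show "adds_bubble I Q (?B - C) C" unfolding adds_bubble_def using 1 C by auto
qed

text \<open>
  Every down-set is reached from the empty set by adding bubbles. This replaces the choice of a
  linear extension in telescoping arguments.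
\<close>
lemma down_set_bubble_induct [consumes 3, case_names empty add]:
  assumes "finite I" and Q: "preorder_on I Q" and "down_set I Q D"
    and empty: "R {}"
    and add: "\<And>A C. adds_bubble I Q A C \<Longrightarrow> R A \<Longrightarrow> R (A \<union> C)"
  shows "R D"
  using assms(3)
proof (induction "card D" arbitrary: D rule: less_induct)
  case less
  have tr: "(x, y) \<in> Q \<Longrightarrow> (y, v) \<in> Q \<Longrightarrow> (x, v) \<in> Q" for x y v
    using Q by (auto simp: preorder_on_def trans_def)
  have DI: "D \<subseteq> I" using less.prems by (simp add: down_set_def)
  have finD: "finite D" using DI assms(1) by (rule finite_subset)
  show ?case
  proof (cases "D = {}")
    case False
    (* An element with the most predecessors lies in a maximal bubble, which can be removed. *)
    let ?h = "\<lambda>x. card {y. (y, x) \<in> Q}"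
    have "Max (?h ` D) \<in> ?h ` D" using False finD by (intro Max_in) auto
    then obtain x where x: "x \<in> D" "?h x = Max (?h ` D)" by auto
    have max: "(y, x) \<in> Q" if y: "y \<in> D" "(x, y) \<in> Q" for y
    proof -
      have "finite {v. (v, y) \<in> Q}"
        by (rule finite_subset[OF _ assms(1)]) (use Q in \<open>auto simp: preorder_on_def\<close>)
      moreover have "{v. (v, x) \<in> Q} \<subseteq> {v. (v, y) \<in> Q}" using tr y by blast
      moreover have "?h y \<le> ?h x" using x y finD by simp
      ultimately have "{v. (v, x) \<in> Q} = {v. (v, y) \<in> Q}" by (intro card_seteq) auto
      moreover have "(y, y) \<in> Q" using Q y DI by (auto simp: preorder_on_def refl_on_def)
      ultimately show ?thesis by blast
    qed
    obtain C where C: "C \<in> bubbles I Q" "x \<in> C" using bubble_of_elem[OF Q] x DI by blast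
    have CD: "C \<subseteq> D"
      using bubble_related[OF Q C] less.prems x by (auto simp: down_set_def)
    have "down_set I Q (D - C)"
      unfolding down_set_def
    proof (intro conjI ballI allI impI)
      show "D - C \<subseteq> I" using DI by blast
      fix y u assume y: "y \<in> D - C" and uy: "(u, y) \<in> Q"
      have "u \<notin> C"
      proof
        assume u: "u \<in> C"
        hence "(x, u) \<in> Q" using bubble_related[OF Q C] by blast
        hence "(x, y) \<in> Q" using uy tr by blast
        moreover from this have "(y, x) \<in> Q" using max y by blast
        ultimately show False using bubble_related[OF Q C] y by blast
      qed
      thus "u \<in> D - C" using y uy less.prems by (auto simp: down_set_def)
    qed
    moreover have "card (D - C) < card D"
      using finD C CD x by (intro psubset_card_mono) auto
    ultimately have "R (D - C)" "adds_bubble I Q (D - C) C"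
      using less CD C by (auto simp: adds_bubble_def Un_absorb1 Un_commute[of D])
    moreover have "(D - C) \<union> C = D" using CD by blast
    ultimately show ?thesis using add[of "D - C" C] by simp
  qed (simp add: empty)
qed

section \<open>The function of a face\<close>

locale compatible_preorder =
  fixes I :: "'a set" and Q :: "'a rel" and z :: "'a set \<Rightarrow> ereal"
  assumes fin: "finite I" and sub: "z \<in> submodular_funs I"
    and pre: "preorder_on I Q" and comp: "compatible I Q z"
begin

abbreviation w :: "'a set \<Rightarrow> ereal" where "w \<equiv> lower_fun I Q z"

lemmas down_set_induct [consumes 1, case_names empty add] = down_set_bubble_induct[OF fin pre]

lemma finite_on_down_sets: "down_set I Q A \<Longrightarrow> z A < \<infinity>"
  using comp by (simp add: compatible_def)

lemma down_set_realE:
  assumes "down_set I Q A"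
  obtains r where "z A = ereal r"
  using submodular_realE[OF sub _ finite_on_down_sets[OF assms]] assms by (auto simp: down_set_def)

lemma convex_minor_added:
  assumes "adds_bubble I Q A C" "U \<subseteq> C"
  shows "convex_minor I Q z C U = z (A \<union> U) - z A"
proof -
  have C: "(A \<union> C) - A = C" using adds_bubbleD(3)[OF assms(1)] by blast
  have "convex_minor I Q z C = minor z A (A \<union> C)"
    using convex_minor_eq[OF sub comp adds_bubbleD(1,4)[OF assms(1)]] unfolding C by blast
  thus ?thesis using assms(2) by (simp add: minor_def C)
qed

lemma convex_minor_not_MInfty:
  assumes "C \<in> bubbles I Q" "U \<subseteq> C"
  shows "convex_minor I Q z C U \<noteq> -\<infinity>"
proof -
  obtain A where A: "adds_bubble I Q A C" using bubble_added[OF pre assms(1)] by blast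
  obtain a where a: "z A = ereal a" using down_set_realE adds_bubbleD(1)[OF A] by blast
  have "z (A \<union> U) \<noteq> -\<infinity>"
    using submodular_not_MInfty[OF sub, of "A \<union> U"] adds_bubbleD(5,6)[OF A] assms(2) by blast
  thus ?thesis unfolding convex_minor_added[OF A assms(2)] a by (cases "z (A \<union> U)") simp_all
qed

lemma lower_fun_sum:
  assumes "E \<subseteq> I"
  shows "w E = (\<Sum>C\<in>bubbles I Q. convex_minor I Q z C (E \<inter> C))"
  using assms by (simp add: lower_fun_def product_fun_def Union_bubbles[OF pre])

lemma convex_minor_empty: "C \<in> bubbles I Q \<Longrightarrow> convex_minor I Q z C {} = 0"
  using bubble_added[OF pre] convex_minor_added[of _ C "{}"] down_set_realE adds_bubbleD(1)
  by (metis Un_empty_right empty_subsetI ereal_minus(1) diff_self zero_ereal_def)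

lemma lower_added:
  assumes A: "adds_bubble I Q A C" and E: "E \<subseteq> C"
  shows "w E = z (A \<union> E) - z A"
proof -
  note C = adds_bubbleD(2)[OF A]
  have EI: "E \<subseteq> I" using E adds_bubbleD(6)[OF A] by blast
  have "convex_minor I Q z D (E \<inter> D) = 0" if D: "D \<in> bubbles I Q - {C}" for D
  proof -
    have "E \<inter> D = {}" using bubbles_disjoint[OF pre C] D E by blast
    thus ?thesis using convex_minor_empty D by simp
  qed
  hence "w E = convex_minor I Q z C (E \<inter> C)"
    unfolding lower_fun_sum[OF EI]
    by (subst sum.remove[OF finite_bubbles[OF fin] C]) simp
  thus ?thesis using convex_minor_added[OF A E] E by (simp add: Int_absorb2)
qed

text \<open>The function \<open>w\<close> is a sum over bubbles, and each of them lies on one side of \<open>D\<close>.\<close>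
lemma lower_split:
  assumes D: "saturated I Q D" and E: "E \<subseteq> I"
  shows "w E = w (E \<inter> D) + w (E - D)"
proof -
  have s: "E \<inter> D \<subseteq> I" "E - D \<subseteq> I" using E by auto
  have "convex_minor I Q z C (E \<inter> C) =
      convex_minor I Q z C (E \<inter> D \<inter> C) + convex_minor I Q z C ((E - D) \<inter> C)"
    if C: "C \<in> bubbles I Q" for C
  proof (cases "C \<subseteq> D")
    case True
    hence "E \<inter> D \<inter> C = E \<inter> C" "(E - D) \<inter> C = {}" by auto
    thus ?thesis using convex_minor_empty[OF C] by simp
  next
    case False
    hence "C \<inter> D = {}" using D C by (auto simp: saturated_def)
    hence "E \<inter> D \<inter> C = {}" "(E - D) \<inter> C = E \<inter> C" by auto
    thus ?thesis using convex_minor_empty[OF C] by simp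
  qed
  thus ?thesis
    unfolding lower_fun_sum[OF E] lower_fun_sum[OF s(1)] lower_fun_sum[OF s(2)]
    by (simp add: sum.distrib)
qed

lemma lower_not_MInfty: "E \<subseteq> I \<Longrightarrow> w E \<noteq> -\<infinity>"
  unfolding lower_fun_sum by (rule sum_not_MInfty) (use convex_minor_not_MInfty in auto)

lemma lower_empty: "w {} = 0"
  using lower_fun_sum[of "{}"] convex_minor_empty by simp

lemma lower_down_set: "down_set I Q A \<Longrightarrow> w A = z A"
proof (induction rule: down_set_induct)
  case empty
  show ?case using lower_empty submodular_empty[OF sub] by simp
next
  case (add A C)
  note A = adds_bubbleD[OF add(1)]
  have "(A \<union> C) \<inter> A = A" "(A \<union> C) - A = C" using A(3) by auto
  hence "w (A \<union> C) = z A + (z (A \<union> C) - z A)"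
    using lower_split[OF saturated_down_set[OF pre A(1)], of "A \<union> C"] A(5,6) add(2)
      lower_added[OF add(1) subset_refl] by simp
  moreover obtain a where "z A = ereal a" using down_set_realE[OF A(1)] by blast
  ultimately show ?case by (cases "z (A \<union> C)") simp_all
qed

text \<open>Inside a single step of the chain there is no difference between \<open>w\<close> and \<open>z\<close>.\<close>
lemma lower_between:
  assumes "adds_bubble I Q A C" "E \<subseteq> C"
  shows "w (A \<union> E) = z (A \<union> E)"
proof -
  note A = adds_bubbleD[OF assms(1)]
  have e: "(A \<union> E) \<inter> A = A" "(A \<union> E) - A = E" using A(3) assms(2) by auto
  have s: "A \<union> E \<subseteq> I" using A assms(2) by auto
  obtain a where a: "z A = ereal a" using down_set_realE[OF A(1)] by blast
  have "w (A \<union> E) = z A + (z (A \<union> E) - z A)"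
    using lower_split[OF saturated_down_set[OF pre A(1)] s] e lower_down_set[OF A(1)]
      lower_added[OF assms] by simp
  thus ?thesis unfolding a by (cases "z (A \<union> E)") simp_all
qed

text \<open>
  The modular equation for \<open>E\<close> and \<open>F\<close> is only asked of their traces on the bubbles. This serves both
  for modular \<open>z\<close> and for tight lattices of non-modular \<open>z\<close>.
\<close>
lemma lower_modular_if:
  assumes E: "E \<subseteq> I" "F \<subseteq> I"
    and mod: "\<And>A C. adds_bubble I Q A C \<Longrightarrow>
      z (A \<union> (E \<inter> C)) < \<infinity> \<Longrightarrow> z (A \<union> (F \<inter> C)) < \<infinity> \<Longrightarrow>
      z ((A \<union> (E \<inter> C)) \<union> (A \<union> (F \<inter> C))) + z ((A \<union> (E \<inter> C)) \<inter> (A \<union> (F \<inter> C)))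
        = z (A \<union> (E \<inter> C)) + z (A \<union> (F \<inter> C))"
    and w: "w E < \<infinity>" "w F < \<infinity>"
  shows "w (E \<union> F) + w (E \<inter> F) = w E + w F"
proof -
  have s: "E \<union> F \<subseteq> I" "E \<inter> F \<subseteq> I" using E by auto
  have "convex_minor I Q z C ((E \<union> F) \<inter> C) + convex_minor I Q z C ((E \<inter> F) \<inter> C)
      = convex_minor I Q z C (E \<inter> C) + convex_minor I Q z C (F \<inter> C)" if C: "C \<in> bubbles I Q" for C
  proof -
    obtain A where A: "adds_bubble I Q A C" using bubble_added[OF pre C] by blast
    obtain a where a: "z A = ereal a" using down_set_realE adds_bubbleD(1)[OF A] by blast
    have fin': "z (A \<union> (G \<inter> C)) < \<infinity>" if G: "G \<subseteq> I" "w G < \<infinity>" for G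
    proof -
      have "convex_minor I Q z C (G \<inter> C) \<noteq> \<infinity>"
        using G(2) C finite_bubbles[OF fin] unfolding lower_fun_sum[OF G(1)]
        by (metis ereal_infty_less(1) sum_Pinfty)
      hence "z (A \<union> (G \<inter> C)) - z A \<noteq> \<infinity>" using convex_minor_added[OF A, of "G \<inter> C"] by simp
      thus ?thesis unfolding a by (cases "z (A \<union> (G \<inter> C))") auto
    qed
    have "G \<subseteq> I \<Longrightarrow> z (A \<union> (G \<inter> C)) \<noteq> -\<infinity>" for G
      using submodular_not_MInfty[OF sub, of "A \<union> (G \<inter> C)"] adds_bubbleD(5,6)[OF A] by blast
    note nm = this[OF E(1)] this[OF E(2)] this[OF s(1)] this[OF s(2)]
    have "z ((A \<union> (E \<inter> C)) \<union> (A \<union> (F \<inter> C))) + z ((A \<union> (E \<inter> C)) \<inter> (A \<union> (F \<inter> C)))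
        = z (A \<union> (E \<inter> C)) + z (A \<union> (F \<inter> C))"
      by (rule mod[OF A fin'[OF E(1) w(1)] fin'[OF E(2) w(2)]])
    moreover have "(A \<union> (E \<inter> C)) \<union> (A \<union> (F \<inter> C)) = A \<union> ((E \<union> F) \<inter> C)"
      "(A \<union> (E \<inter> C)) \<inter> (A \<union> (F \<inter> C)) = A \<union> ((E \<inter> F) \<inter> C)" by auto
    ultimately have "z (A \<union> ((E \<union> F) \<inter> C)) + z (A \<union> ((E \<inter> F) \<inter> C))
        = z (A \<union> (E \<inter> C)) + z (A \<union> (F \<inter> C))" by simp
    moreover have "z (A \<union> (E \<inter> C)) < \<infinity>" "z (A \<union> (F \<inter> C)) < \<infinity>" using fin' E w by auto
    ultimately show ?thesis
      using nm unfolding convex_minor_added[OF A Int_lower2] a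
      by (cases "z (A \<union> (E \<inter> C))"; cases "z (A \<union> (F \<inter> C))"; cases "z (A \<union> ((E \<union> F) \<inter> C))";
          cases "z (A \<union> ((E \<inter> F) \<inter> C))") simp_all
  qed
  thus ?thesis
    unfolding lower_fun_sum[OF E(1)] lower_fun_sum[OF E(2)] lower_fun_sum[OF s(1)]
      lower_fun_sum[OF s(2)] by (simp flip: sum.distrib)
qed

lemma lower_ineq:
  assumes E: "E \<subseteq> I" "F \<subseteq> I"
  shows "w (E \<union> F) + w (E \<inter> F) \<le> w E + w F"
proof -
  have s: "E \<union> F \<subseteq> I" "E \<inter> F \<subseteq> I" using E by auto
  have "convex_minor I Q z C ((E \<union> F) \<inter> C) + convex_minor I Q z C ((E \<inter> F) \<inter> C)
      \<le> convex_minor I Q z C (E \<inter> C) + convex_minor I Q z C (F \<inter> C)" if C: "C \<in> bubbles I Q" for C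
  proof -
    obtain A where A: "adds_bubble I Q A C" using bubble_added[OF pre C] by blast
    obtain a where a: "z A = ereal a" using down_set_realE adds_bubbleD(1)[OF A] by blast
    have AI: "A \<union> (G \<inter> C) \<subseteq> I" for G using adds_bubbleD(5,6)[OF A] by blast
    note nm = submodular_not_MInfty[OF sub AI]
    have "z ((A \<union> (E \<inter> C)) \<union> (A \<union> (F \<inter> C))) + z ((A \<union> (E \<inter> C)) \<inter> (A \<union> (F \<inter> C)))
        \<le> z (A \<union> (E \<inter> C)) + z (A \<union> (F \<inter> C))"
      by (rule submodular_ineq[OF sub AI AI])
    moreover have "(A \<union> (E \<inter> C)) \<union> (A \<union> (F \<inter> C)) = A \<union> ((E \<union> F) \<inter> C)"
      "(A \<union> (E \<inter> C)) \<inter> (A \<union> (F \<inter> C)) = A \<union> ((E \<inter> F) \<inter> C)" by auto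
    ultimately have "z (A \<union> ((E \<union> F) \<inter> C)) + z (A \<union> ((E \<inter> F) \<inter> C))
        \<le> z (A \<union> (E \<inter> C)) + z (A \<union> (F \<inter> C))" by simp
    thus ?thesis
      using nm[of E] nm[of F] nm[of "E \<union> F"] nm[of "E \<inter> F"]
      unfolding convex_minor_added[OF A Int_lower2] a
      by (cases "z (A \<union> (E \<inter> C))"; cases "z (A \<union> (F \<inter> C))"; cases "z (A \<union> ((E \<union> F) \<inter> C))";
          cases "z (A \<union> ((E \<inter> F) \<inter> C))") simp_all
  qed
  thus ?thesis
    unfolding lower_fun_sum[OF E(1)] lower_fun_sum[OF E(2)] lower_fun_sum[OF s(1)]
      lower_fun_sum[OF s(2)] by (simp add: sum_mono flip: sum.distrib)
qed

lemma lower_submodular: "w \<in> submodular_funs I"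
proof -
  have "w \<in> extensional (Pow I)"
    by (simp add: lower_fun_def product_fun_def Union_bubbles[OF pre])
  moreover have "w I < \<infinity>"
    using lower_down_set[OF down_set_top[OF pre]] submodular_top[OF sub] by simp
  ultimately show ?thesis
    using lower_ineq lower_empty lower_not_MInfty by (auto simp: submodular_funs_def PiE_iff)
qed

lemma lower_modular:
  assumes "z \<in> modular_funs I"
  shows "w \<in> modular_funs I"
proof -
  have m: "z A < \<infinity> \<Longrightarrow> z B < \<infinity> \<Longrightarrow> z (A \<union> B) + z (A \<inter> B) = z A + z B"
    if "A \<subseteq> I" "B \<subseteq> I" for A B using assms that by (simp add: modular_funs_def)
  have "w (E \<union> F) + w (E \<inter> F) = w E + w F"
    if "E \<subseteq> I" "F \<subseteq> I" "w E < \<infinity>" "w F < \<infinity>" for E F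
    by (rule lower_modular_if[OF that(1,2) _ that(3,4)], rule m)
      (use that adds_bubbleD(5) in blast)+
  thus ?thesis using lower_submodular by (simp add: modular_funs_def)
qed

text \<open>
  Along a chain of down-sets, \<open>lower_cut\<close> gives the increment of \<open>w\<close> and \<open>cut_ineq\<close> bounds the
  increment of \<open>z\<close> from below by the same quantity. Summation gives \<open>w \<le> z\<close>; equality for a set \<open>E\<close>
  means equality at each step.
\<close>
lemma lower_cut:
  assumes A: "adds_bubble I Q A C" and E: "E \<subseteq> I"
  shows "w (E \<inter> (A \<union> C)) = w (E \<inter> A) + (z (A \<union> (E \<inter> C)) - z A)"
proof -
  have "(E \<inter> (A \<union> C)) \<inter> A = E \<inter> A" "(E \<inter> (A \<union> C)) - A = E \<inter> C"
    using adds_bubbleD(3)[OF A] by auto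
  thus ?thesis
    using lower_split[OF saturated_down_set[OF pre adds_bubbleD(1)[OF A]], of "E \<inter> (A \<union> C)"] E
      lower_added[OF A, of "E \<inter> C"] by (metis Int_lower2 le_infI1)
qed

lemma cut_ineq:
  assumes A: "adds_bubble I Q A C" and E: "E \<subseteq> I"
  shows "z (A \<union> (E \<inter> C)) + z (E \<inter> A) \<le> z A + z (E \<inter> (A \<union> C))"
proof -
  have "A \<union> (E \<inter> (A \<union> C)) = A \<union> (E \<inter> C)" "A \<inter> (E \<inter> (A \<union> C)) = E \<inter> A" by auto
  thus ?thesis
    using submodular_ineq[OF sub, of A "E \<inter> (A \<union> C)"] adds_bubbleD(5)[OF A] E by auto
qed

lemma lower_le:
  assumes E: "E \<subseteq> I"
  shows "w E \<le> z E"
proof -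
  have "w (E \<inter> D) \<le> z (E \<inter> D)" if "down_set I Q D" for D
    using that
  proof (induction rule: down_set_induct)
    case empty
    show ?case using lower_empty submodular_empty[OF sub] by simp
  next
    case (add A C)
    obtain a where a: "z A = ereal a" using down_set_realE adds_bubbleD(1)[OF add(1)] by blast
    have s: "A \<union> (E \<inter> C) \<subseteq> I" "E \<inter> A \<subseteq> I" "E \<inter> (A \<union> C) \<subseteq> I"
      using E adds_bubbleD(5)[OF add(1)] by auto
    show ?case
      using cut_ineq[OF add(1) E] add(2) lower_not_MInfty[OF s(2)] submodular_not_MInfty[OF sub s(1)]
        submodular_not_MInfty[OF sub s(2)] submodular_not_MInfty[OF sub s(3)]
      unfolding lower_cut[OF add(1) E] a
      by (cases "z (A \<union> (E \<inter> C))"; cases "z (E \<inter> A)"; cases "z (E \<inter> (A \<union> C))"; cases "w (E \<inter> A)")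
        simp_all
  qed
  from this[OF down_set_top[OF pre]] show ?thesis using E by (simp add: Int_absorb2)
qed

text \<open>
  On a tight lattice containing the chain, each step of the telescoping is an equation, because all
  the sets in \<open>cut_ineq\<close> belong to the lattice.
\<close>
lemma lower_eq_on_finer:
  assumes L: "tight_lattice I z L" and QL: "down_sets I Q \<subseteq> L" and E: "E \<in> L"
  shows "w E = z E"
proof -
  have EI: "E \<subseteq> I" using E tight_latticeD(1)[OF L] by blast
  have QL': "down_set I Q A \<Longrightarrow> A \<in> L" for A using QL by (auto simp: down_sets_def)
  have "w (E \<inter> D) = z (E \<inter> D)" if "down_set I Q D" for D
    using that
  proof (induction rule: down_set_induct)
    case empty
    show ?case using lower_empty submodular_empty[OF sub] by simp
  next
    case (add A C)
    note A = adds_bubbleD[OF add(1)]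
    obtain a where a: "z A = ereal a" using down_set_realE A(1) by blast
    have s: "A \<union> (E \<inter> C) \<subseteq> I" "E \<inter> A \<subseteq> I" "E \<inter> (A \<union> C) \<subseteq> I" using EI A(5) by auto
    have e: "A \<inter> (E \<inter> (A \<union> C)) = E \<inter> A" "A \<union> (E \<inter> (A \<union> C)) = A \<union> (E \<inter> C)" by auto
    have L1: "E \<inter> (A \<union> C) \<in> L" using tight_latticeD(5)[OF L E QL'[OF A(4)]] .
    have L2: "E \<inter> A \<in> L" using tight_latticeD(5)[OF L E QL'[OF A(1)]] .
    have "z A + z (E \<inter> (A \<union> C)) = z (E \<inter> A) + z (A \<union> (E \<inter> C))"
      using tight_latticeD(7)[OF L QL'[OF A(1)] L1] unfolding e .
    thus ?case
      using add(2) tight_latticeD(4)[OF L L1] tight_latticeD(4)[OF L L2]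
        submodular_not_MInfty[OF sub s(1)]
        submodular_not_MInfty[OF sub s(2)] submodular_not_MInfty[OF sub s(3)]
      unfolding lower_cut[OF add(1) EI] a
      by (cases "z (A \<union> (E \<inter> C))"; cases "z (E \<inter> A)"; cases "z (E \<inter> (A \<union> C))")
        simp_all
  qed
  from this[OF down_set_top[OF pre]] show ?thesis using EI by (simp add: Int_absorb2)
qed

text \<open>
  Conversely, if \<open>w\<close> and \<open>z\<close> agree at \<open>E\<close>, every step of the telescoping is an equation, so tightness
  puts \<open>E \<inter> (A \<union> C)\<close> into the lattice as soon as \<open>E \<inter> A\<close> and \<open>A \<union> (E \<inter> C)\<close> are there.
  Finiteness of \<open>w E\<close> is what allows cancellation.
\<close>
lemma mem_finer_if_lower_eq:
  assumes L: "tight_lattice I z L" and QL: "down_sets I Q \<subseteq> L" and EI: "E \<subseteq> I"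
    and cut: "\<And>A C. adds_bubble I Q A C \<Longrightarrow> A \<union> (E \<inter> C) \<in> L"
    and eq: "w E = z E" and fE: "w E < \<infinity>"
  shows "E \<in> L"
proof -
  have QL': "down_set I Q A \<Longrightarrow> A \<in> L" for A using QL by (auto simp: down_sets_def)
  have "w (E \<inter> D) = z (E \<inter> D) \<longrightarrow> w (E \<inter> D) < \<infinity> \<longrightarrow> E \<inter> D \<in> L" if "down_set I Q D" for D
    using that
  proof (induction rule: down_set_induct)
    case empty
    show ?case using tight_latticeD(2)[OF L] by simp
  next
    case (add A C)
    note A = adds_bubbleD[OF add(1)]
    obtain a where a: "z A = ereal a" using down_set_realE A(1) by blast
    have s: "A \<union> (E \<inter> C) \<subseteq> I" "E \<inter> A \<subseteq> I" "E \<inter> (A \<union> C) \<subseteq> I" using EI A(5) by auto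
    have e: "A \<inter> (E \<inter> (A \<union> C)) = E \<inter> A" "A \<union> (E \<inter> (A \<union> C)) = A \<union> (E \<inter> C)" by auto
    show ?case
    proof (intro impI)
      assume eq: "w (E \<inter> (A \<union> C)) = z (E \<inter> (A \<union> C))" and f: "w (E \<inter> (A \<union> C)) < \<infinity>"
      have *: "w (E \<inter> A) = z (E \<inter> A) \<and> w (E \<inter> A) < \<infinity> \<and>
          z A + z (E \<inter> (A \<union> C)) = z (E \<inter> A) + z (A \<union> (E \<inter> C))"
        using cut_ineq[OF add(1) EI] eq f lower_le[OF s(2)] lower_not_MInfty[OF s(2)]
          submodular_not_MInfty[OF sub s(1)]
          submodular_not_MInfty[OF sub s(2)] submodular_not_MInfty[OF sub s(3)]
        unfolding lower_cut[OF add(1) EI] a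
        by (cases "z (A \<union> (E \<inter> C))"; cases "z (E \<inter> A)"; cases "z (E \<inter> (A \<union> C))"; cases "w (E \<inter> A)")
          simp_all
      hence "E \<inter> A \<in> L" using add(2) by blast
      thus "E \<inter> (A \<union> C) \<in> L"
        using tight_latticeD(8)[OF L A(5) s(3)] cut[OF add(1)] * unfolding e by blast
    qed
  qed
  from this[OF down_set_top[OF pre]] show ?thesis using EI eq fE by (simp add: Int_absorb2)
qed

end

section \<open>Tight lattices of a face and of its cone\<close>

text \<open>
  If \<open>X\<close> and \<open>Y\<close> are in the new lattice, then
  \<open>z (X \<union> Y) + z (X \<inter> Y) \<le> z X + z Y = w X + w Y = w (X \<union> Y) + w (X \<inter> Y)\<close>, and \<open>w \<le> z\<close> makes
  this an equality in each term; the other direction runs the same argument from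
  \<open>X \<inter> Y\<close> and \<open>X \<union> Y\<close>.
\<close>
lemma tight_lattice_below:
  assumes z: "z \<in> submodular_funs I" and w: "w \<in> submodular_funs I"
    and le: "\<And>A. A \<subseteq> I \<Longrightarrow> w A \<le> z A" and top: "w I = z I"
    and K: "tight_lattice I w K"
  shows "tight_lattice I z {A \<in> K. z A = w A}"
proof (rule tight_latticeI)
  note D = tight_latticeD[OF K]
  show "{A \<in> K. z A = w A} \<subseteq> Pow I" using D(1) by blast
  show "{} \<in> {A \<in> K. z A = w A}" "I \<in> {A \<in> K. z A = w A}"
    using D(2,3) top submodular_empty[OF z] submodular_empty[OF w] by simp_all
  show "X \<in> {A \<in> K. z A = w A} \<Longrightarrow> z X < \<infinity>" for X using D(4) by simp
next
  note D = tight_latticeD[OF K]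
  fix X Y assume "X \<in> {A \<in> K. z A = w A}" "Y \<in> {A \<in> K. z A = w A}"
  hence X: "X \<in> K" "z X = w X" and Y: "Y \<in> K" "z Y = w Y" by auto
  have XI: "X \<subseteq> I" "Y \<subseteq> I" using X Y D(1) by auto
  hence s: "X \<inter> Y \<subseteq> I" "X \<union> Y \<subseteq> I" by auto
  note IU = D(5)[OF X(1) Y(1)] D(6)[OF X(1) Y(1)]
  obtain r1 r2 where r: "w (X \<inter> Y) = ereal r1" "w (X \<union> Y) = ereal r2"
    using submodular_realE[OF w s(1) D(4)[OF IU(1)]] submodular_realE[OF w s(2) D(4)[OF IU(2)]]
    by metis
  have "z (X \<union> Y) + z (X \<inter> Y) \<le> w (X \<inter> Y) + w (X \<union> Y)"
    using submodular_ineq[OF z XI] D(7)[OF X(1) Y(1)] X Y by simp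
  hence "z (X \<inter> Y) = w (X \<inter> Y) \<and> z (X \<union> Y) = w (X \<union> Y)"
    using le[OF s(1)] le[OF s(2)] unfolding r by (cases "z (X \<inter> Y)"; cases "z (X \<union> Y)") simp_all
  thus "X \<inter> Y \<in> {A \<in> K. z A = w A} \<and> X \<union> Y \<in> {A \<in> K. z A = w A} \<and>
      z X + z Y = z (X \<inter> Y) + z (X \<union> Y)"
    using IU D(7)[OF X(1) Y(1)] X Y by simp
next
  note D = tight_latticeD[OF K]
  fix X Y assume XI: "X \<subseteq> I" "Y \<subseteq> I" and "X \<inter> Y \<in> {A \<in> K. z A = w A}" "X \<union> Y \<in> {A \<in> K. z A = w A}"
    and eq: "z X + z Y = z (X \<inter> Y) + z (X \<union> Y)"
  hence IU: "X \<inter> Y \<in> K" "X \<union> Y \<in> K" "z (X \<inter> Y) = w (X \<inter> Y)" "z (X \<union> Y) = w (X \<union> Y)" by auto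
  have s: "X \<inter> Y \<subseteq> I" "X \<union> Y \<subseteq> I" using XI by auto
  obtain r1 r2 where r: "w (X \<inter> Y) = ereal r1" "w (X \<union> Y) = ereal r2"
    using submodular_realE[OF w s(1) D(4)[OF IU(1)]] submodular_realE[OF w s(2) D(4)[OF IU(2)]]
    by metis
  have *: "w X + w Y = w (X \<inter> Y) + w (X \<union> Y) \<and> z X = w X \<and> z Y = w Y"
    using le[OF XI(1)] le[OF XI(2)] submodular_ineq[OF w XI] eq submodular_not_MInfty[OF w XI(1)]
      submodular_not_MInfty[OF w XI(2)]
    unfolding IU r by (cases "z X"; cases "z Y"; cases "w X"; cases "w Y") simp_all
  thus "X \<in> {A \<in> K. z A = w A} \<and> Y \<in> {A \<in> K. z A = w A}"
    using D(8)[OF XI IU(1,2)] by simp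
qed

text \<open>
  On \<open>L\<close> the function \<open>z\<close> is modular, so for the cone the equation in the definition of a tight
  lattice says no more than that the four values are finite.
\<close>
lemma tight_lattice_upper_iff:
  assumes L: "tight_lattice I z L"
  shows "tight_lattice I (\<lambda>A\<in>Pow I. if A \<in> L then z A else \<infinity>) M \<longleftrightarrow> tight_lattice I z M \<and> M \<subseteq> L"
    (is "tight_lattice I ?u M \<longleftrightarrow> _")
proof (intro iffI conjI)
  note D = tight_latticeD[OF L]
  have u: "A \<in> L \<Longrightarrow> ?u A = z A" for A using D(1) by auto
  assume M: "tight_lattice I ?u M"
  note E = tight_latticeD[OF M]
  show MsubL: "M \<subseteq> L"
  proof
    fix A assume "A \<in> M"
    thus "A \<in> L" using E(4)[of A] E(1) by (auto split: if_splits)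
  qed
  show "tight_lattice I z M"
  proof (rule tight_latticeI)
    show "M \<subseteq> Pow I" "{} \<in> M" "I \<in> M" using E(1-3) .
    show "X \<in> M \<Longrightarrow> z X < \<infinity>" for X using D(4) MsubL by blast
    show "X \<inter> Y \<in> M \<and> X \<union> Y \<in> M \<and> z X + z Y = z (X \<inter> Y) + z (X \<union> Y)"
      if "X \<in> M" "Y \<in> M" for X Y
      using E(5,6)[OF that] D(7)[of X Y] that MsubL by blast
    show "X \<in> M \<and> Y \<in> M" if "X \<subseteq> I" "Y \<subseteq> I" and IU: "X \<inter> Y \<in> M" "X \<union> Y \<in> M"
      and eq: "z X + z Y = z (X \<inter> Y) + z (X \<union> Y)" for X Y
    proof -
      have IUL: "X \<inter> Y \<in> L" "X \<union> Y \<in> L" using IU MsubL by auto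
      have "X \<in> L" "Y \<in> L" using D(8)[OF that(1,2) IUL eq] by auto
      hence "?u X + ?u Y = ?u (X \<inter> Y) + ?u (X \<union> Y)" using eq IUL by (simp only: u)
      thus ?thesis using E(8)[OF that(1-4)] by blast
    qed
  qed
next
  note D = tight_latticeD[OF L]
  have u: "A \<in> L \<Longrightarrow> ?u A = z A" for A using D(1) by auto
  assume M: "tight_lattice I z M \<and> M \<subseteq> L"
  note E = tight_latticeD[OF conjunct1[OF M]]
  have MsubL: "A \<in> M \<Longrightarrow> A \<in> L" for A using M by blast
  show "tight_lattice I ?u M"
  proof (rule tight_latticeI)
    show "M \<subseteq> Pow I" "{} \<in> M" "I \<in> M" using E(1-3) .
    show "X \<in> M \<Longrightarrow> ?u X < \<infinity>" for X using u[OF MsubL] E(4) by simp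
    show "X \<inter> Y \<in> M \<and> X \<union> Y \<in> M \<and> ?u X + ?u Y = ?u (X \<inter> Y) + ?u (X \<union> Y)"
      if "X \<in> M" "Y \<in> M" for X Y
      using E(5-7)[OF that] that by (simp only: u MsubL simp_thms)
    show "X \<in> M \<and> Y \<in> M" if XI: "X \<subseteq> I" "Y \<subseteq> I" and IU: "X \<inter> Y \<in> M" "X \<union> Y \<in> M"
      and eq: "?u X + ?u Y = ?u (X \<inter> Y) + ?u (X \<union> Y)" for X Y
    proof -
      have "?u X + ?u Y = z (X \<inter> Y) + z (X \<union> Y)" using eq IU by (simp only: u MsubL)
      moreover have "z (X \<inter> Y) < \<infinity>" "z (X \<union> Y) < \<infinity>" using E(4) IU by auto
      ultimately have f: "?u X + ?u Y < \<infinity>" by simp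
      have "?u X \<noteq> \<infinity>" "?u Y \<noteq> \<infinity>" using f by auto
      hence "X \<in> L" "Y \<in> L" using XI by (auto split: if_splits)
      hence "z X + z Y = z (X \<inter> Y) + z (X \<union> Y)" using eq IU by (simp only: u MsubL)
      thus ?thesis using E(8)[OF XI IU] by blast
    qed
  qed
qed

lemma upper_fun_eq: "upper_fun I P z = (\<lambda>A\<in>Pow I. if A \<in> down_sets I P then z A else \<infinity>)"
  by (simp add: upper_fun_def down_sets_def)

lemma upper_finite_iff:
  assumes "z \<in> submodular_funs I" "P \<in> Pre I z" "A \<subseteq> I"
  shows "upper_fun I P z A < \<infinity> \<longleftrightarrow> down_set I P A"
proof -
  have "z A < \<infinity>" if "down_set I P A"
    using assms(2) that unfolding Pre_def conforms_def compatible_def by blast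
  thus ?thesis using assms(3) by (cases "down_set I P A") (simp_all add: upper_fun_def)
qed

lemma upper_modular:
  assumes z: "z \<in> submodular_funs I" and P: "P \<in> Pre I z"
  shows "upper_fun I P z \<in> modular_funs I"
proof -
  let ?u = "upper_fun I P z"
  have po: "preorder_on I P" using P by (simp add: Pre_def)
  note D = tight_latticeD[OF Pre_iff_tight_lattice[OF z po, THEN iffD1, OF P]]
  have u: "A \<in> down_sets I P \<Longrightarrow> ?u A = z A" for A using D(1) by (auto simp: upper_fun_eq)
  have fin: "A \<in> down_sets I P" if "A \<subseteq> I" "?u A \<noteq> \<infinity>" for A
    using that by (auto simp: upper_fun_eq split: if_splits)
  have nm: "?u A \<noteq> -\<infinity>" if "A \<subseteq> I" for A
    using submodular_not_MInfty[OF z that] that by (simp add: upper_fun_eq)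
  have m: "?u (A \<union> B) + ?u (A \<inter> B) = ?u A + ?u B"
    if "A \<subseteq> I" "B \<subseteq> I" "?u A \<noteq> \<infinity>" "?u B \<noteq> \<infinity>" for A B
  proof -
    note AB = fin[OF that(1,3)] fin[OF that(2,4)]
    show ?thesis
      unfolding u[OF AB(1)] u[OF AB(2)] u[OF D(5)[OF AB]] u[OF D(6)[OF AB]] D(7)[OF AB]
      by (rule add.commute)
  qed
  have "?u (A \<union> B) + ?u (A \<inter> B) \<le> ?u A + ?u B" if "A \<subseteq> I" "B \<subseteq> I" for A B
  proof (cases "?u A = \<infinity> \<or> ?u B = \<infinity>")
    case True
    hence top: "?u A + ?u B = \<infinity>" using nm[OF that(1)] nm[OF that(2)] by auto
    show ?thesis unfolding top by simp
  next
    case False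
    hence "?u A \<noteq> \<infinity>" "?u B \<noteq> \<infinity>" by simp_all
    from m[OF that this] show ?thesis by (rule eq_refl)
  qed
  moreover have "?u \<in> extensional (Pow I)" by (simp add: upper_fun_def)
  moreover have "?u {} = 0" using u[OF D(2)] submodular_empty[OF z] by simp
  moreover have "?u I < \<infinity>" using u[OF D(3)] D(4)[OF D(3)] by simp
  ultimately have "?u \<in> submodular_funs I"
    using nm unfolding submodular_funs_def PiE_iff by blast
  moreover have "?u (A \<union> B) + ?u (A \<inter> B) = ?u A + ?u B"
    if "A \<subseteq> I" "B \<subseteq> I" "?u A < \<infinity>" "?u B < \<infinity>" for A B
    using m[OF that(1,2)] that(3,4) by auto
  ultimately show ?thesis unfolding modular_funs_def by blast
qed

lemma Pre_upper_iff:
  assumes z: "z \<in> submodular_funs I" and P: "P \<in> Pre I z"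
  shows "R \<in> Pre I (upper_fun I P z) \<longleftrightarrow> R \<in> Pre I z \<and> down_sets I R \<subseteq> down_sets I P"
proof (cases "preorder_on I R")
  case True
  have po: "preorder_on I P" using P by (simp add: Pre_def)
  have u: "upper_fun I P z \<in> submodular_funs I"
    using upper_modular[OF z P] by (simp add: modular_funs_def)
  show ?thesis
    unfolding Pre_iff_tight_lattice[OF u True] Pre_iff_tight_lattice[OF z True]
    unfolding upper_fun_eq
    by (rule tight_lattice_upper_iff[OF Pre_iff_tight_lattice[OF z po, THEN iffD1, OF P]])
qed (simp add: Pre_def)

lemma pre_upper:
  assumes "finite I" and z: "z \<in> submodular_funs I" and P: "P \<in> Pre I z"
  shows "pre I (upper_fun I P z) = P"
proof -
  have u: "upper_fun I P z \<in> submodular_funs I"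
    using upper_modular[OF z P] by (simp add: modular_funs_def)
  have "preorder_on I P" using P by (simp add: Pre_def)
  thus ?thesis unfolding pre_def
    using upper_finite_iff[OF z P] by (intro the1_equality pre_ex1[OF assms(1) u]) simp
qed

lemma preorder_subset_if_down_sets:
  assumes P: "preorder_on I P" and Q: "preorder_on I Q" and "down_sets I Q \<subseteq> down_sets I P"
  shows "P \<subseteq> Q"
proof
  fix p assume "p \<in> P"
  then obtain x y where p: "p = (x, y)" "(x, y) \<in> P" by (cases p) auto
  have "y \<in> I" using p P by (auto simp: preorder_on_def)
  have "down_set I Q {v. (v, y) \<in> Q}"
    unfolding down_set_def
  proof (intro conjI ballI allI impI)
    show "{v. (v, y) \<in> Q} \<subseteq> I" using Q by (auto simp: preorder_on_def)
    show "a \<in> {v. (v, y) \<in> Q}" if "b \<in> {v. (v, y) \<in> Q}" "(a, b) \<in> Q" for a b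
      using Q that unfolding preorder_on_def trans_def by blast
  qed
  hence "down_set I P {v. (v, y) \<in> Q}" using assms(3) by (auto simp: down_sets_def)
  moreover have "(y, y) \<in> Q" using Q \<open>y \<in> I\<close> by (auto simp: preorder_on_def refl_on_def)
  ultimately show "p \<in> Q" using p unfolding down_set_def by blast
qed

lemma preorder_eq_if_down_sets:
  "preorder_on I P \<Longrightarrow> preorder_on I Q \<Longrightarrow> down_sets I P = down_sets I Q \<Longrightarrow> P = Q"
  by (simp add: preorder_subset_if_down_sets subset_antisym)

text \<open>
  The finite form of Birkhoff's correspondence, obtained from the preorder of the submodular function
  that vanishes on \<open>L\<close> and is infinite elsewhere.
\<close>
lemma ex_preorder_with_down_sets:
  assumes "finite I" "L \<subseteq> Pow I" "{} \<in> L" "I \<in> L"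
    and Int: "\<And>X Y. X \<in> L \<Longrightarrow> Y \<in> L \<Longrightarrow> X \<inter> Y \<in> L" and Un: "\<And>X Y. X \<in> L \<Longrightarrow> Y \<in> L \<Longrightarrow> X \<union> Y \<in> L"
  obtains P where "preorder_on I P" "down_sets I P = L"
proof -
  let ?u = "\<lambda>A\<in>Pow I. if A \<in> L then 0 else (\<infinity>::ereal)"
  have "?u (A \<union> B) + ?u (A \<inter> B) \<le> ?u A + ?u B" if "A \<subseteq> I" "B \<subseteq> I" for A B
  proof -
    have "A \<union> B \<subseteq> I" "A \<inter> B \<subseteq> I" using that by auto
    thus ?thesis using that Int[of A B] Un[of A B] by simp
  qed
  hence u: "?u \<in> submodular_funs I"
    using assms(3,4) by (simp add: submodular_funs_def PiE_iff)
  obtain P where P: "preorder_on I P" "\<And>A. A \<subseteq> I \<Longrightarrow> down_set I P A \<longleftrightarrow> ?u A < \<infinity>"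
    using pre_ex1[OF assms(1) u] by blast
  have "down_set I P A \<longleftrightarrow> A \<in> L" for A
  proof (cases "A \<subseteq> I")
    case True
    thus ?thesis using P(2)[OF True] by simp
  next
    case False
    thus ?thesis using assms(2) by (auto simp: down_set_def)
  qed
  thus thesis using that[OF P(1)] by (simp add: down_sets_def)
qed

section \<open>Faces of a face\<close>

context compatible_preorder
begin

text \<open>
  The sets whose trace on each bubble of \<open>Q\<close> belongs to the minor of \<open>L\<close> at that bubble.
\<close>
definition bubblewise :: "'a set set \<Rightarrow> 'a set set" where
  "bubblewise L = {E. E \<subseteq> I \<and> (\<forall>A C. adds_bubble I Q A C \<longrightarrow> A \<union> (E \<inter> C) \<in> L)}"

lemma lower_finite_iff:
  assumes "E \<subseteq> I"
  shows "w E < \<infinity> \<longleftrightarrow> (\<forall>A C. adds_bubble I Q A C \<longrightarrow> z (A \<union> (E \<inter> C)) < \<infinity>)"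
proof -
  have *: "convex_minor I Q z C (E \<inter> C) = \<infinity> \<longleftrightarrow> z (A \<union> (E \<inter> C)) = \<infinity>"
    if A: "adds_bubble I Q A C" for A C
  proof -
    obtain a where "z A = ereal a" using down_set_realE[OF adds_bubbleD(1)[OF A]] by blast
    thus ?thesis using convex_minor_added[OF A, of "E \<inter> C"] by (cases "z (A \<union> (E \<inter> C))") simp_all
  qed
  have "w E = \<infinity> \<longleftrightarrow> (\<exists>C\<in>bubbles I Q. convex_minor I Q z C (E \<inter> C) = \<infinity>)"
    unfolding lower_fun_sum[OF assms] sum_Pinfty using finite_bubbles[OF fin] by auto
  also have "\<dots> \<longleftrightarrow> (\<exists>A C. adds_bubble I Q A C \<and> z (A \<union> (E \<inter> C)) = \<infinity>)"
  proof
    assume "\<exists>C\<in>bubbles I Q. convex_minor I Q z C (E \<inter> C) = \<infinity>"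
    then obtain C where C: "C \<in> bubbles I Q" "convex_minor I Q z C (E \<inter> C) = \<infinity>" by blast
    obtain A where A: "adds_bubble I Q A C" using bubble_added[OF pre C(1)] by blast
    show "\<exists>A C. adds_bubble I Q A C \<and> z (A \<union> (E \<inter> C)) = \<infinity>" using A *[OF A] C(2) by blast
  next
    assume "\<exists>A C. adds_bubble I Q A C \<and> z (A \<union> (E \<inter> C)) = \<infinity>"
    then obtain A C where A: "adds_bubble I Q A C" "z (A \<union> (E \<inter> C)) = \<infinity>" by blast
    thus "\<exists>C\<in>bubbles I Q. convex_minor I Q z C (E \<inter> C) = \<infinity>"
      using *[OF A(1)] adds_bubbleD(2)[OF A(1)] by blast
  qed
  finally show ?thesis by auto
qed

text \<open>
  A product of faces is a face of the product. The nontrivial point is that an equation for \<open>w\<close> is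
  an equation on each bubble: the parts inside and outside a bubble satisfy submodular
  inequalities, and these add up to an equation of finite numbers.
\<close>
lemma bubblewise_tight:
  assumes L: "tight_lattice I z L" and QL: "down_sets I Q \<subseteq> L"
  shows "tight_lattice I w (bubblewise L)"
proof (rule tight_latticeI)
  note D = tight_latticeD[OF L]
  have AL: "A \<in> L" "A \<union> C \<in> L" if "adds_bubble I Q A C" for A C
    using adds_bubbleD(1,4)[OF that] QL by (auto simp: down_sets_def)
  show "bubblewise L \<subseteq> Pow I" by (auto simp: bubblewise_def)
  show "{} \<in> bubblewise L" using AL by (simp add: bubblewise_def)
  have "I \<inter> C = C" if "adds_bubble I Q A C" for A C using adds_bubbleD(6)[OF that] by blast
  thus "I \<in> bubblewise L" using AL unfolding bubblewise_def by simp
  show "w X < \<infinity>" if "X \<in> bubblewise L" for X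
    using that lower_finite_iff[of X] D(4) by (simp add: bubblewise_def)
next
  note D = tight_latticeD[OF L]
  fix X Y assume "X \<in> bubblewise L" "Y \<in> bubblewise L"
  hence X: "X \<subseteq> I" "\<And>A C. adds_bubble I Q A C \<Longrightarrow> A \<union> (X \<inter> C) \<in> L"
    and Y: "Y \<subseteq> I" "\<And>A C. adds_bubble I Q A C \<Longrightarrow> A \<union> (Y \<inter> C) \<in> L"
    by (simp_all add: bubblewise_def)
  have e: "A \<union> ((X \<inter> Y) \<inter> C) = (A \<union> (X \<inter> C)) \<inter> (A \<union> (Y \<inter> C))"
    "A \<union> ((X \<union> Y) \<inter> C) = (A \<union> (X \<inter> C)) \<union> (A \<union> (Y \<inter> C))" for A C by auto
  have "X \<inter> Y \<in> bubblewise L" "X \<union> Y \<in> bubblewise L"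
    using X(1) Y(1) D(5,6)[OF X(2) Y(2)] unfolding bubblewise_def mem_Collect_eq e by blast+
  moreover have "w (X \<union> Y) + w (X \<inter> Y) = w X + w Y"
  proof (rule lower_modular_if[OF X(1) Y(1)])
    show "w X < \<infinity>" "w Y < \<infinity>"
      using D(4)[OF X(2)] D(4)[OF Y(2)] unfolding lower_finite_iff[OF X(1)] lower_finite_iff[OF Y(1)]
      by blast+
    show "z ((A \<union> (X \<inter> C)) \<union> (A \<union> (Y \<inter> C))) + z ((A \<union> (X \<inter> C)) \<inter> (A \<union> (Y \<inter> C)))
        = z (A \<union> (X \<inter> C)) + z (A \<union> (Y \<inter> C))" if "adds_bubble I Q A C" for A C
      using D(7)[OF X(2)[OF that] Y(2)[OF that]] by (simp only: add.commute)
  qed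
  ultimately show "X \<inter> Y \<in> bubblewise L \<and> X \<union> Y \<in> bubblewise L \<and>
      w X + w Y = w (X \<inter> Y) + w (X \<union> Y)"
    by (simp only: add.commute[of "w (X \<inter> Y)"] simp_thms)
next
  note D = tight_latticeD[OF L]
  fix X Y assume XI: "X \<subseteq> I" "Y \<subseteq> I" and IU: "X \<inter> Y \<in> bubblewise L" "X \<union> Y \<in> bubblewise L"
    and eq: "w X + w Y = w (X \<inter> Y) + w (X \<union> Y)"
  have "A \<union> (X \<inter> C) \<in> L \<and> A \<union> (Y \<inter> C) \<in> L" if A: "adds_bubble I Q A C" for A C
  proof -
    note AC = adds_bubbleD[OF A]
    have sat: "saturated I Q C" using saturated_bubble[OF pre AC(2)] .
    obtain a where a: "z A = ereal a" using down_set_realE[OF AC(1)] by blast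
    have e: "(A \<union> (X \<inter> C)) \<inter> (A \<union> (Y \<inter> C)) = A \<union> ((X \<inter> Y) \<inter> C)"
      "(A \<union> (X \<inter> C)) \<union> (A \<union> (Y \<inter> C)) = A \<union> ((X \<union> Y) \<inter> C)" by auto
    have IUL: "A \<union> ((X \<inter> Y) \<inter> C) \<in> L" "A \<union> ((X \<union> Y) \<inter> C) \<in> L"
      using IU A unfolding bubblewise_def by blast+
    have s: "X \<inter> C \<subseteq> I" "Y \<inter> C \<subseteq> I" "X - C \<subseteq> I" "Y - C \<subseteq> I" "X \<inter> Y \<subseteq> I" "X \<union> Y \<subseteq> I"
      "A \<union> (X \<inter> C) \<subseteq> I" "A \<union> (Y \<inter> C) \<subseteq> I"
      using XI AC(5,6) by auto
    have wI: "w (X \<inter> Y) < \<infinity>" "w (X \<union> Y) < \<infinity>"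
      using IU D(4) unfolding bubblewise_def lower_finite_iff[OF s(5)] lower_finite_iff[OF s(6)]
      by blast+
    have i1: "w ((X \<union> Y) \<inter> C) + w ((X \<inter> Y) \<inter> C) \<le> w (X \<inter> C) + w (Y \<inter> C)"
    proof -
      have "X \<inter> C \<union> Y \<inter> C = (X \<union> Y) \<inter> C" "X \<inter> C \<inter> (Y \<inter> C) = (X \<inter> Y) \<inter> C" by auto
      thus ?thesis using lower_ineq[OF s(1,2)] by simp
    qed
    have i2: "w ((X \<union> Y) - C) + w ((X \<inter> Y) - C) \<le> w (X - C) + w (Y - C)"
    proof -
      have "(X - C) \<union> (Y - C) = (X \<union> Y) - C" "(X - C) \<inter> (Y - C) = (X \<inter> Y) - C" by auto
      thus ?thesis using lower_ineq[OF s(3,4)] by simp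
    qed
    note sp = lower_split[OF sat XI(1)] lower_split[OF sat XI(2)]
      lower_split[OF sat s(5)] lower_split[OF sat s(6)]
    have nm: "w (X \<inter> C) \<noteq> -\<infinity>" "w (Y \<inter> C) \<noteq> -\<infinity>" "w (X - C) \<noteq> -\<infinity>" "w (Y - C) \<noteq> -\<infinity>"
      "w ((X \<inter> Y) \<inter> C) \<noteq> -\<infinity>" "w ((X \<inter> Y) - C) \<noteq> -\<infinity>"
      "w ((X \<union> Y) \<inter> C) \<noteq> -\<infinity>" "w ((X \<union> Y) - C) \<noteq> -\<infinity>"
      by (rule lower_not_MInfty, use XI in blast)+
    obtain b1 b2 where b: "w ((X \<inter> Y) \<inter> C) = ereal b1" "w ((X \<inter> Y) - C) = ereal b2"
      using nm(5,6) wI(1) unfolding sp(3)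
      by (cases "w ((X \<inter> Y) \<inter> C)"; cases "w ((X \<inter> Y) - C)") simp_all
    obtain d1 d2 where d: "w ((X \<union> Y) \<inter> C) = ereal d1" "w ((X \<union> Y) - C) = ereal d2"
      using nm(7,8) wI(2) unfolding sp(4)
      by (cases "w ((X \<union> Y) \<inter> C)"; cases "w ((X \<union> Y) - C)") simp_all
    have "w (X \<inter> C) + w (Y \<inter> C) = w ((X \<inter> Y) \<inter> C) + w ((X \<union> Y) \<inter> C)"
      using i1 i2 eq nm(1-4) unfolding sp b d
      by (cases "w (X \<inter> C)"; cases "w (Y \<inter> C)"; cases "w (X - C)"; cases "w (Y - C)") simp_all
    hence "z (A \<union> (X \<inter> C)) + z (A \<union> (Y \<inter> C)) = z (A \<union> ((X \<inter> Y) \<inter> C)) + z (A \<union> ((X \<union> Y) \<inter> C))"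
      using submodular_not_MInfty[OF sub s(7)] submodular_not_MInfty[OF sub s(8)]
        D(4)[OF IUL(1)] D(4)[OF IUL(2)]
      unfolding lower_added[OF A Int_lower2] a
      by (cases "z (A \<union> (X \<inter> C))"; cases "z (A \<union> (Y \<inter> C))"; cases "z (A \<union> ((X \<inter> Y) \<inter> C))";
          cases "z (A \<union> ((X \<union> Y) \<inter> C))") simp_all
    thus ?thesis using D(8)[OF s(7,8)] IUL unfolding e by blast
  qed
  thus "X \<in> bubblewise L \<and> Y \<in> bubblewise L" using XI by (simp add: bubblewise_def)
qed

text \<open>
  As \<open>w\<close> is split by \<open>D\<close>, the sets \<open>D\<close> and \<open>I - D\<close> satisfy the tightness equation with
  \<open>{}\<close> and \<open>I\<close>.
\<close>
lemma saturated_in_tight_lattice: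
  assumes K: "tight_lattice I w K" and D: "saturated I Q D"
  shows "D \<in> K"
proof -
  have DI: "D \<subseteq> I" "I - D \<subseteq> I" using D by (auto simp: saturated_def)
  have e: "D \<inter> (I - D) = {}" "D \<union> (I - D) = I" "I \<inter> D = D" using DI by auto
  have "w D + w (I - D) = w {} + w I"
    using lower_split[OF D subset_refl] lower_empty by (simp add: e)
  thus ?thesis
    using tight_latticeD(8)[OF K DI] tight_latticeD(2,3)[OF K] unfolding e by blast
qed

text \<open>
  The tight sets, with respect to the whole polytope, of a face with lattice \<open>K\<close> of the face \<open>w\<close>.
\<close>
definition glue_lattice :: "'a set set \<Rightarrow> 'a set set" where
  "glue_lattice K = {A \<in> K. z A = w A}"

lemma glue_lattice_tight: "tight_lattice I w K \<Longrightarrow> tight_lattice I z (glue_lattice K)"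
  unfolding glue_lattice_def
  using lower_le lower_down_set[OF down_set_top[OF pre]]
  by (intro tight_lattice_below[OF sub lower_submodular]) auto

lemma down_sets_subset_glue_lattice:
  assumes "tight_lattice I w K"
  shows "down_sets I Q \<subseteq> glue_lattice K"
  using saturated_in_tight_lattice[OF assms saturated_down_set[OF pre]] lower_down_set
  by (auto simp: glue_lattice_def down_sets_def)

text \<open>
  The sets \<open>A\<close>, \<open>C\<close> of a step are saturated and so belong to \<open>K\<close>. Hence \<open>E \<in> K\<close> is equivalent to
  \<open>A \<union> (E \<inter> C) \<in> K\<close> for all steps, and there \<open>w\<close> and \<open>z\<close> agree by \<open>lower_between\<close>.
\<close>
lemma bubblewise_glue_lattice:
  assumes K: "tight_lattice I w K"
  shows "bubblewise (glue_lattice K) = K"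
proof (rule subset_antisym; rule subsetI)
  note D = tight_latticeD[OF K]
  fix E assume E: "E \<in> K"
  have EI: "E \<subseteq> I" using E D(1) by auto
  have "A \<union> (E \<inter> C) \<in> glue_lattice K" if A: "adds_bubble I Q A C" for A C
  proof -
    note AC = adds_bubbleD[OF A]
    have "A \<in> K" "C \<in> K"
      using saturated_in_tight_lattice[OF K] saturated_down_set[OF pre AC(1)]
        saturated_bubble[OF pre AC(2)] by blast+
    thus ?thesis
      using E D(5,6) lower_between[OF A, of "E \<inter> C"] by (simp add: glue_lattice_def)
  qed
  thus "E \<in> bubblewise (glue_lattice K)" using EI by (simp add: bubblewise_def)
next
  note D = tight_latticeD[OF K]
  fix E assume "E \<in> bubblewise (glue_lattice K)"
  hence EI: "E \<subseteq> I" and E: "\<And>A C. adds_bubble I Q A C \<Longrightarrow> A \<union> (E \<inter> C) \<in> K"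
    by (auto simp: bubblewise_def glue_lattice_def)
  have "E \<inter> F \<in> K" if "down_set I Q F" for F
    using that
  proof (induction rule: down_set_induct)
    case empty
    show ?case using D(2) by simp
  next
    case (add A C)
    have "C \<in> K"
      using saturated_in_tight_lattice[OF K saturated_bubble[OF pre adds_bubbleD(2)[OF add(1)]]] .
    hence "(A \<union> (E \<inter> C)) \<inter> C \<in> K" using E[OF add(1)] D(5) by blast
    moreover have "(A \<union> (E \<inter> C)) \<inter> C = E \<inter> C" using adds_bubbleD(3)[OF add(1)] by auto
    ultimately have "(E \<inter> A) \<union> (E \<inter> C) \<in> K" using D(6)[OF add(2)] by simp
    thus ?case by (simp add: Int_Un_distrib)
  qed
  from this[OF down_set_top[OF pre]] show "E \<in> K" using EI by (simp add: Int_absorb2)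
qed

lemma glue_lattice_bubblewise:
  assumes L: "tight_lattice I z L" and QL: "down_sets I Q \<subseteq> L"
  shows "glue_lattice (bubblewise L) = L"
proof (rule subset_antisym; rule subsetI)
  note D = tight_latticeD[OF L]
  fix E assume E: "E \<in> L"
  have "A \<union> (E \<inter> C) \<in> L" if A: "adds_bubble I Q A C" for A C
  proof -
    have "A \<in> L" "A \<union> C \<in> L" using adds_bubbleD(1,4)[OF A] QL by (auto simp: down_sets_def)
    hence "A \<union> (E \<inter> (A \<union> C)) \<in> L" using E D(5,6) by blast
    moreover have "A \<union> (E \<inter> (A \<union> C)) = A \<union> (E \<inter> C)" by auto
    ultimately show ?thesis by simp
  qed
  thus "E \<in> glue_lattice (bubblewise L)"
    using lower_eq_on_finer[OF L QL E] D(1) E by (auto simp: glue_lattice_def bubblewise_def)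
next
  note D = tight_latticeD[OF L]
  fix E assume "E \<in> glue_lattice (bubblewise L)"
  hence E: "E \<subseteq> I" "\<And>A C. adds_bubble I Q A C \<Longrightarrow> A \<union> (E \<inter> C) \<in> L" "w E = z E"
    by (auto simp: glue_lattice_def bubblewise_def)
  have "w E < \<infinity>" using lower_finite_iff[OF E(1)] E(2) D(4) by blast
  thus "E \<in> L" using mem_finer_if_lower_eq[OF L QL E] by blast
qed

text \<open>
  A trace \<open>E \<inter> C\<close> on a bubble is closed downwards under \<open>R\<close> inside \<open>C\<close> if and only if it becomes a
  down-set of \<open>R\<close> once \<open>A\<close> is adjoined, because \<open>A\<close> and \<open>A \<union> C\<close> are already down-sets of \<open>R\<close>.
\<close>
lemma down_sets_bubblewise:
  assumes R: "preorder_on I R" and QR: "down_sets I Q \<subseteq> down_sets I R"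
  shows "down_sets I (R \<inter> (Q \<inter> Q\<inverse>)) = bubblewise (down_sets I R)"
proof (rule subset_antisym; rule subsetI)
  have QR': "down_set I Q A \<Longrightarrow> down_set I R A" for A using QR by (auto simp: down_sets_def)
  fix E assume "E \<in> down_sets I (R \<inter> (Q \<inter> Q\<inverse>))"
  hence E: "down_set I (R \<inter> (Q \<inter> Q\<inverse>)) E" by (simp add: down_sets_def)
  have "down_set I R (A \<union> (E \<inter> C))" if A: "adds_bubble I Q A C" for A C
    unfolding down_set_def
  proof (intro conjI ballI allI impI)
    note AC = adds_bubbleD[OF A]
    show "A \<union> (E \<inter> C) \<subseteq> I" using AC(5,6) by auto
    fix y x assume y: "y \<in> A \<union> (E \<inter> C)" and xy: "(x, y) \<in> R"
    have x: "x \<in> A \<union> C" using QR'[OF AC(4)] y xy unfolding down_set_def by blast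
    show "x \<in> A \<union> (E \<inter> C)"
    proof (cases "x \<in> A")
      case False
      hence "x \<in> C" using x by blast
      have "y \<notin> A" using QR'[OF AC(1)] xy False unfolding down_set_def by blast
      hence yEC: "y \<in> E" "y \<in> C" using y by auto
      hence "(x, y) \<in> R \<inter> (Q \<inter> Q\<inverse>)"
        using bubble_related[OF pre AC(2) \<open>x \<in> C\<close>, of y] xy by blast
      thus ?thesis using E yEC \<open>x \<in> C\<close> unfolding down_set_def by blast
    qed simp
  qed
  thus "E \<in> bubblewise (down_sets I R)"
    using E by (simp add: bubblewise_def down_sets_def down_set_def)
next
  fix E assume "E \<in> bubblewise (down_sets I R)"
  hence EI: "E \<subseteq> I" and E: "\<And>A C. adds_bubble I Q A C \<Longrightarrow> down_set I R (A \<union> (E \<inter> C))"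
    by (simp_all add: bubblewise_def down_sets_def)
  have "x \<in> E" if "y \<in> E" "(x, y) \<in> R" "(x, y) \<in> Q" "(y, x) \<in> Q" for x y
  proof -
    have "y \<in> I" using that(1) EI by blast
    then obtain C where C: "C \<in> bubbles I Q" "y \<in> C" using bubble_of_elem[OF pre] by blast
    obtain A where A: "adds_bubble I Q A C" using bubble_added[OF pre C(1)] by blast
    have "x \<in> C" using bubble_related[OF pre C] that by blast
    moreover have "x \<in> A \<union> (E \<inter> C)" using E[OF A] that C unfolding down_set_def by blast
    ultimately show ?thesis using adds_bubbleD(3)[OF A] by blast
  qed
  thus "E \<in> down_sets I (R \<inter> (Q \<inter> Q\<inverse>))"
    using EI by (auto simp: down_sets_def down_set_def)
qed

end

lemma ex_preorder_with_tight_lattice: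
  assumes "finite I" and L: "tight_lattice I z L"
  obtains P where "preorder_on I P" "down_sets I P = L"
proof (rule ex_preorder_with_down_sets[OF assms(1) tight_latticeD(1-3)[OF L]])
  show "X \<inter> Y \<in> L" if "X \<in> L" "Y \<in> L" for X Y by (rule tight_latticeD(5)[OF L that])
  show "X \<union> Y \<in> L" if "X \<in> L" "Y \<in> L" for X Y by (rule tight_latticeD(6)[OF L that])
qed

lemma upper_upper:
  assumes "down_sets I Q \<subseteq> down_sets I R"
  shows "upper_fun I Q (upper_fun I R z) = upper_fun I Q z"
proof -
  have "down_set I Q A \<Longrightarrow> down_set I R A" for A using assms by (auto simp: down_sets_def)
  thus ?thesis unfolding upper_fun_def by (intro restrict_ext) simp
qed

context compatible_preorder
begin

text \<open>The preorder of a face \<open>P\<close> of \<open>w\<close>, regarded as a face of \<open>z\<close>.\<close>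
definition glue :: "'a rel \<Rightarrow> 'a rel" where
  "glue P = (SOME R. preorder_on I R \<and> down_sets I R = glue_lattice (down_sets I P))"

lemma tight_if_Pre_lower:
  assumes "P \<in> Pre I w"
  shows "tight_lattice I w (down_sets I P)"
proof -
  have "preorder_on I P" using assms by (simp add: Pre_def)
  from Pre_iff_tight_lattice[OF lower_submodular this] assms show ?thesis by blast
qed

lemma glue_down_sets:
  assumes P: "P \<in> Pre I w"
  shows "preorder_on I (glue P)" "down_sets I (glue P) = glue_lattice (down_sets I P)"
proof -
  let ?good = "\<lambda>R. preorder_on I R \<and> down_sets I R = glue_lattice (down_sets I P)"
  obtain R where "preorder_on I R" "down_sets I R = glue_lattice (down_sets I P)"
    by (rule ex_preorder_with_tight_lattice[OF fin glue_lattice_tight[OF tight_if_Pre_lower[OF P]]])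
  hence "?good R" by simp
  hence "?good (glue P)" unfolding glue_def by (rule someI[of ?good])
  thus "preorder_on I (glue P)" "down_sets I (glue P) = glue_lattice (down_sets I P)" by simp_all
qed

lemma glue_in_Pre:
  assumes P: "P \<in> Pre I w"
  shows "glue P \<in> Pre I z"
  unfolding Pre_iff_tight_lattice[OF sub glue_down_sets(1)[OF P]] glue_down_sets(2)[OF P]
  by (rule glue_lattice_tight[OF tight_if_Pre_lower[OF P]])

lemma down_sets_subset_glue:
  assumes P: "P \<in> Pre I w"
  shows "down_sets I Q \<subseteq> down_sets I (glue P)"
  unfolding glue_down_sets(2)[OF P]
  by (rule down_sets_subset_glue_lattice[OF tight_if_Pre_lower[OF P]])

lemma preorder_Int_bubbles:
  assumes "preorder_on I R"
  shows "preorder_on I (R \<inter> (Q \<inter> Q\<inverse>))"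
proof -
  have "trans (R \<inter> (Q \<inter> Q\<inverse>))"
    using pre assms by (intro trans_Int) (simp_all add: preorder_on_def)
  moreover have "refl_on I (R \<inter> (Q \<inter> Q\<inverse>))"
    using pre assms unfolding preorder_on_def refl_on_def by blast
  ultimately show ?thesis using assms unfolding preorder_on_def by blast
qed

lemma glue_Int_bubbles:
  assumes P: "P \<in> Pre I w"
  shows "glue P \<inter> (Q \<inter> Q\<inverse>) = P"
proof (rule preorder_eq_if_down_sets[OF preorder_Int_bubbles])
  show "preorder_on I (glue P)" by (rule glue_down_sets(1)[OF P])
  show "preorder_on I P" using P by (simp add: Pre_def)
  show "down_sets I (glue P \<inter> (Q \<inter> Q\<inverse>)) = down_sets I P"
    unfolding down_sets_bubblewise[OF glue_down_sets(1)[OF P] down_sets_subset_glue[OF P]]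
    unfolding glue_down_sets(2)[OF P]
    by (rule bubblewise_glue_lattice[OF tight_if_Pre_lower[OF P]])
qed

lemma Int_bubbles_in_Pre:
  assumes R: "R \<in> Pre I z" and QR: "down_sets I Q \<subseteq> down_sets I R"
  shows "R \<inter> (Q \<inter> Q\<inverse>) \<in> Pre I w"
proof -
  have po: "preorder_on I R" using R by (simp add: Pre_def)
  show ?thesis
    unfolding Pre_iff_tight_lattice[OF lower_submodular preorder_Int_bubbles[OF po]]
      down_sets_bubblewise[OF po QR]
    by (rule bubblewise_tight[OF Pre_iff_tight_lattice[OF sub po, THEN iffD1, OF R] QR])
qed

lemma glue_of_Int_bubbles:
  assumes R: "R \<in> Pre I z" and QR: "down_sets I Q \<subseteq> down_sets I R"
  shows "glue (R \<inter> (Q \<inter> Q\<inverse>)) = R"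
proof (rule preorder_eq_if_down_sets)
  have po: "preorder_on I R" using R by (simp add: Pre_def)
  note P = Int_bubbles_in_Pre[OF R QR]
  show "preorder_on I (glue (R \<inter> (Q \<inter> Q\<inverse>)))" by (rule glue_down_sets(1)[OF P])
  show "preorder_on I R" by (rule po)
  have T: "tight_lattice I z (down_sets I R)"
    by (rule Pre_iff_tight_lattice[OF sub po, THEN iffD1, OF R])
  show "down_sets I (glue (R \<inter> (Q \<inter> Q\<inverse>))) = down_sets I R"
    unfolding glue_down_sets(2)[OF P] down_sets_bubblewise[OF po QR]
    by (rule glue_lattice_bubblewise[OF T QR])
qed

text \<open>
  The bubbles are those of \<open>R\<close> on both sides. A bubble \<open>D\<close> of \<open>R\<close> lies in a bubble \<open>C\<close> of \<open>Q\<close>, so it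
  can be presented as \<open>(X \<union> D) - X\<close> with \<open>A \<subseteq> X\<close> and \<open>X \<union> D \<subseteq> A \<union> C\<close>, where \<open>w\<close> and \<open>z\<close> agree.
\<close>
lemma lower_lower:
  assumes R: "R \<in> Pre I z" and QR: "down_sets I Q \<subseteq> down_sets I R"
  shows "lower_fun I (R \<inter> (Q \<inter> Q\<inverse>)) w = lower_fun I R z"
proof -
  let ?P = "R \<inter> (Q \<inter> Q\<inverse>)"
  have po: "preorder_on I R" using R by (simp add: Pre_def)
  have P: "?P \<in> Pre I w" by (rule Int_bubbles_in_Pre[OF R QR])
  interpret R: compatible_preorder I R z
    using fin sub po R by unfold_locales (auto simp: Pre_def conforms_def)
  interpret P: compatible_preorder I ?P w
    using fin lower_submodular P by unfold_locales (auto simp: Pre_def conforms_def)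
  have "R \<subseteq> Q" by (rule preorder_subset_if_down_sets[OF po pre QR])
  hence "?P \<inter> ?P\<inverse> = R \<inter> R\<inverse>" by blast
  hence bub: "bubbles I ?P = bubbles I R" by (simp add: bubbles_def)
  have "convex_minor I ?P w D U = convex_minor I R z D U"
    if D: "D \<in> bubbles I R" and U: "U \<subseteq> D" for D U
  proof -
    have "D \<noteq> {}"
      using in_quotient_imp_non_empty[OF equiv_bubbles[OF po]] D unfolding bubbles_def by blast
    then obtain x where x: "x \<in> D" by blast
    have "x \<in> I" using x bubble_subset[OF po D] by blast
    then obtain C where C: "C \<in> bubbles I Q" "x \<in> C" using bubble_of_elem[OF pre] by blast
    have DC: "D \<subseteq> C"
    proof
      fix y assume "y \<in> D"
      hence "(x, y) \<in> R \<and> (y, x) \<in> R" using bubble_related[OF po D x] by blast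
      thus "y \<in> C" using bubble_related[OF pre C] \<open>R \<subseteq> Q\<close> by blast
    qed
    obtain A where A: "adds_bubble I Q A C" using bubble_added[OF pre C(1)] by blast
    obtain X0 where X0: "adds_bubble I R X0 D" using bubble_added[OF po D] by blast
    note AC = adds_bubbleD[OF A] and XD = adds_bubbleD[OF X0]
    have QR': "down_set I Q B \<Longrightarrow> down_set I R B" for B using QR by (auto simp: down_sets_def)
    (* Any presentation X0 of D is moved between A and A \<union> C. *)
    define X where "X = A \<union> (X0 \<inter> (A \<union> C))"
    have X1: "down_set I R X"
      unfolding X_def by (intro down_set_Un down_set_Int QR' AC XD)
    have "down_set I R (A \<union> ((X0 \<union> D) \<inter> (A \<union> C)))"
      by (intro down_set_Un down_set_Int QR' AC XD)
    moreover have "A \<union> ((X0 \<union> D) \<inter> (A \<union> C)) = X \<union> D" using DC by (auto simp: X_def)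
    ultimately have X2: "down_set I R (X \<union> D)" by simp
    have X3: "X \<inter> D = {}" using XD(3) AC(3) DC by (auto simp: X_def)
    have XR: "adds_bubble I R X D" using X1 X2 X3 D by (simp add: adds_bubble_def)
    have "down_set I ?P B" if "down_set I R B" for B
      using that by (auto simp: down_set_def)
    hence XP: "adds_bubble I ?P X D" using X1 X2 X3 D by (simp add: adds_bubble_def bub)
    have e: "w (X \<union> V) = z (X \<union> V)" if "V \<subseteq> D" for V
    proof -
      have "X \<union> V = A \<union> ((X0 \<inter> C) \<union> V)" by (auto simp: X_def)
      moreover have "(X0 \<inter> C) \<union> V \<subseteq> C" using that DC by blast
      ultimately show ?thesis using lower_between[OF A] by simp
    qed
    have "w X = z X" using e[of "{}"] by simp
    thus ?thesis
      unfolding P.convex_minor_added[OF XP U] R.convex_minor_added[OF XR U] e[OF U] by simp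
  qed
  thus ?thesis unfolding lower_fun_def product_fun_def bub
    by (intro restrict_ext sum.cong refl) (simp add: Int_lower2)
qed

text \<open>
  By \<open>down_sets_bubblewise\<close> both sides are finite at \<open>E\<close> exactly when \<open>A \<union> (E \<inter> C)\<close> is a down-set
  of \<open>R\<close> in each step of a chain for \<open>Q\<close>, and then the summands for the bubble \<open>C\<close> agree.
\<close>
lemma lower_upper:
  assumes Q: "Q \<in> Pre I z" and R: "R \<in> Pre I z" and QR: "down_sets I Q \<subseteq> down_sets I R"
  shows "lower_fun I Q (upper_fun I R z) = upper_fun I (R \<inter> (Q \<inter> Q\<inverse>)) w"
proof -
  let ?u = "upper_fun I R z"
  have po: "preorder_on I R" using R by (simp add: Pre_def)
  have "Q \<in> Pre I ?u" using Pre_upper_iff[OF sub R] Q QR by simp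
  then interpret u: compatible_preorder I Q ?u
    using fin upper_modular[OF sub R] pre
    by unfold_locales (auto simp: Pre_def conforms_def modular_funs_def)
  have ext: "?u A = (if down_set I R A then z A else \<infinity>)" if "A \<subseteq> I" for A
    using that by (simp add: upper_fun_def)
  have AI: "A \<union> (E \<inter> C) \<subseteq> I" if "adds_bubble I Q A C" for A C E
    using adds_bubbleD(5,6)[OF that] by blast
  have "u.w E = (if down_set I (R \<inter> (Q \<inter> Q\<inverse>)) E then w E else \<infinity>)" if E: "E \<subseteq> I" for E
  proof (cases "down_set I (R \<inter> (Q \<inter> Q\<inverse>)) E")
    case True
    hence "E \<in> bubblewise (down_sets I R)"
      using down_sets_bubblewise[OF po QR] by (auto simp: down_sets_def)
    hence cut: "down_set I R (A \<union> (E \<inter> C))" if "adds_bubble I Q A C" for A C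
      using that unfolding bubblewise_def down_sets_def by blast
    have "convex_minor I Q ?u C (E \<inter> C) = convex_minor I Q z C (E \<inter> C)"
      if C: "C \<in> bubbles I Q" for C
    proof -
      obtain A where A: "adds_bubble I Q A C" using bubble_added[OF pre C] by blast
      have "A \<in> down_sets I R" using adds_bubbleD(1)[OF A] QR by (auto simp: down_sets_def)
      hence "?u A = z A" using ext[OF adds_bubbleD(5)[OF A]] by (simp add: down_sets_def)
      thus ?thesis
        unfolding u.convex_minor_added[OF A Int_lower2] convex_minor_added[OF A Int_lower2]
        using ext[OF AI[OF A]] cut[OF A] by simp
    qed
    hence "u.w E = w E" unfolding u.lower_fun_sum[OF E] lower_fun_sum[OF E]
      by (intro sum.cong refl)
    thus ?thesis using True by simp
  next
    case False
    hence "E \<notin> bubblewise (down_sets I R)"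
      using down_sets_bubblewise[OF po QR] by (auto simp: down_sets_def)
    then obtain A C where A: "adds_bubble I Q A C" "\<not> down_set I R (A \<union> (E \<inter> C))"
      using E unfolding bubblewise_def down_sets_def by blast
    have "?u (A \<union> (E \<inter> C)) = \<infinity>" using ext[OF AI[OF A(1)]] A(2) by simp
    hence "\<not> u.w E < \<infinity>" unfolding u.lower_finite_iff[OF E] using A(1) by fastforce
    thus ?thesis using False by simp
  qed
  moreover have "u.w \<in> extensional (Pow I)"
    using u.lower_submodular by (auto simp: submodular_funs_def PiE_iff)
  ultimately show ?thesis
    unfolding upper_fun_def[of I "R \<inter> (Q \<inter> Q\<inverse>)"]
    by (intro extensionalityI[of _ "Pow I"]) auto
qed

end

section \<open>The largest face\<close>

text \<open>The unions of connected components of \<open>z\<close>.\<close>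
definition separators :: "'a set \<Rightarrow> ('a set \<Rightarrow> ereal) \<Rightarrow> 'a set set" where
  "separators I z = {A. A \<subseteq> I \<and> z A + z (I - A) = z I}"

lemma separator_split:
  assumes z: "z \<in> submodular_funs I" and A: "A \<in> separators I z" and E: "E \<subseteq> I"
  shows "z E = z (E \<inter> A) + z (E - A)"
proof -
  have AI: "A \<subseteq> I" "z A + z (I - A) = z I" using A by (auto simp: separators_def)
  have "decomposes (minor z {} I) A (I - A)"
    using AI submodular_empty[OF z] submodular_top[OF z]
    by (subst decomposes_minor_iff[OF z]) auto
  hence "minor z {} I E = minor z {} I (E \<inter> A) + minor z {} I (E \<inter> (I - A))"
    using E AI unfolding decomposes_def by (metis Diff_partition)
  moreover have "E \<inter> (I - A) = E - A" "E \<inter> A \<subseteq> I" "E - A \<subseteq> I" using E by auto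
  ultimately show ?thesis using E submodular_empty[OF z] by (simp add: minor_def)
qed

lemma separatorI:
  assumes z: "z \<in> submodular_funs I" and A: "A \<subseteq> I" and le: "z A + z (I - A) \<le> z I"
  shows "A \<in> separators I z"
proof -
  have "z (A \<union> (I - A)) + z (A \<inter> (I - A)) \<le> z A + z (I - A)"
    using A by (intro submodular_ineq[OF z]) auto
  moreover have "A \<union> (I - A) = I" "A \<inter> (I - A) = {}" using A by auto
  ultimately have "z I \<le> z A + z (I - A)" using submodular_empty[OF z] by simp
  thus ?thesis using A le by (simp add: separators_def)
qed

lemma separators_Diff: "A \<in> separators I z \<Longrightarrow> I - A \<in> separators I z"
  by (auto simp: separators_def double_diff add.commute)

lemma separators_Int:
  assumes z: "z \<in> submodular_funs I" and A: "A \<in> separators I z" and B: "B \<in> separators I z"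
  shows "A \<inter> B \<in> separators I z"
proof -
  have AI: "A \<subseteq> I" "B \<subseteq> I" using A B by (auto simp: separators_def)
  have e: "(I - A \<inter> B) \<inter> A = A - B" "(I - A \<inter> B) - A = I - A" using AI by auto
  have "z I = z A + z (I - A)" using A by (simp add: separators_def)
  also have "z A = z (A \<inter> B) + z (A - B)" by (rule separator_split[OF z B AI(1)])
  also have "z (A \<inter> B) + z (A - B) + z (I - A) = z (A \<inter> B) + (z (A - B) + z (I - A))"
    by (rule add.assoc)
  also have "z (A - B) + z (I - A) = z (I - A \<inter> B)"
    using separator_split[OF z A, of "I - A \<inter> B"] unfolding e by simp
  finally show ?thesis using AI by (auto simp: separators_def)
qed

lemma separators_Un:
  assumes z: "z \<in> submodular_funs I" and A: "A \<in> separators I z" and B: "B \<in> separators I z"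
  shows "A \<union> B \<in> separators I z"
proof -
  have "I - ((I - A) \<inter> (I - B)) = A \<union> B" using A B by (auto simp: separators_def)
  thus ?thesis
    using separators_Diff[OF separators_Int[OF z separators_Diff[OF A] separators_Diff[OF B]]] by simp
qed

lemma separator_finite:
  assumes z: "z \<in> submodular_funs I" and A: "A \<in> separators I z"
  shows "z A < \<infinity>"
proof -
  have "A \<subseteq> I" "I - A \<subseteq> I" "z A + z (I - A) < \<infinity>"
    using A submodular_top[OF z] by (auto simp: separators_def)
  thus ?thesis using submodular_not_MInfty[OF z, of "I - A"] by (cases "z A"; cases "z (I - A)") auto
qed

text \<open>
  All values of \<open>z\<close> involved split along separators, so the claims reduce to linear identities
  between the values of \<open>z\<close> on \<open>X \<inter> Y\<close>, \<open>X - Y\<close>, \<open>Y - X\<close> and \<open>I - (X \<union> Y)\<close>.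
\<close>
lemma separators_tight:
  assumes z: "z \<in> submodular_funs I"
  shows "tight_lattice I z (separators I z)"
proof (rule tight_latticeI)
  show "separators I z \<subseteq> Pow I" by (auto simp: separators_def)
  show "{} \<in> separators I z" "I \<in> separators I z"
    using submodular_empty[OF z] by (simp_all add: separators_def)
  show "X \<in> separators I z \<Longrightarrow> z X < \<infinity>" for X by (rule separator_finite[OF z])
next
  fix X Y assume X: "X \<in> separators I z" and Y: "Y \<in> separators I z"
  have XI: "X \<subseteq> I" "Y \<subseteq> I" using X Y by (auto simp: separators_def)
  have e: "(X \<union> Y) \<inter> Y = Y" "(X \<union> Y) - Y = X - Y" by auto
  have "z X = z (X \<inter> Y) + z (X - Y)" by (rule separator_split[OF z Y XI(1)])
  moreover have "z (X \<union> Y) = z Y + z (X - Y)"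
    using separator_split[OF z Y, of "X \<union> Y"] XI unfolding e by simp
  ultimately have "z X + z Y = z (X \<inter> Y) + z (X \<union> Y)" by (simp only: add_ac)
  thus "X \<inter> Y \<in> separators I z \<and> X \<union> Y \<in> separators I z \<and> z X + z Y = z (X \<inter> Y) + z (X \<union> Y)"
    using separators_Int[OF z X Y] separators_Un[OF z X Y] by blast
next
  have half: "X \<in> separators I z"
    if XI: "X \<subseteq> I" "Y \<subseteq> I" and IU: "X \<inter> Y \<in> separators I z" "X \<union> Y \<in> separators I z"
      and eq: "z X + z Y = z (X \<inter> Y) + z (X \<union> Y)" for X Y
  proof (rule separatorI[OF z XI(1)])
    have s: "I - X \<subseteq> I" "X - Y \<subseteq> I" "Y - X \<subseteq> I" "X \<inter> Y \<subseteq> I" "X \<union> Y \<subseteq> I" "I - (X \<union> Y) \<subseteq> I"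
      using XI by auto
    have e: "X \<inter> (X \<inter> Y) = X \<inter> Y" "X - (X \<inter> Y) = X - Y" "Y \<inter> (X \<inter> Y) = X \<inter> Y" "Y - (X \<inter> Y) = Y - X"
      "(I - X) \<inter> (X \<union> Y) = Y - X" "(I - X) - (X \<union> Y) = I - (X \<union> Y)" using XI by auto
    obtain a where a: "z (X \<inter> Y) = ereal a"
      using submodular_realE[OF z s(4) separator_finite[OF z IU(1)]] by blast
    obtain b where b: "z (X \<union> Y) = ereal b"
      using submodular_realE[OF z s(5) separator_finite[OF z IU(2)]] by blast
    have 1: "z X = z (X \<inter> Y) + z (X - Y)" "z Y = z (X \<inter> Y) + z (Y - X)"
      "z (I - X) = z (Y - X) + z (I - (X \<union> Y))"
      using separator_split[OF z IU(1) XI(1)] separator_split[OF z IU(1) XI(2)]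
        separator_split[OF z IU(2) s(1)] unfolding e by simp_all
    have 2: "z I = z (X \<union> Y) + z (I - (X \<union> Y))" using IU(2) by (simp add: separators_def)
    show "z X + z (I - X) \<le> z I"
      using eq submodular_not_MInfty[OF z s(2)] submodular_not_MInfty[OF z s(3)]
        submodular_not_MInfty[OF z s(6)]
      unfolding 1 2 a b
      by (cases "z (X - Y)"; cases "z (Y - X)"; cases "z (I - (X \<union> Y))") simp_all
  qed
  fix X Y assume XI: "X \<subseteq> I" "Y \<subseteq> I" and IU: "X \<inter> Y \<in> separators I z" "X \<union> Y \<in> separators I z"
    and eq: "z X + z Y = z (X \<inter> Y) + z (X \<union> Y)"
  have "Y \<in> separators I z"
    by (rule half[of Y X]) (use XI IU eq in \<open>simp_all add: Int_commute Un_commute add.commute\<close>)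
  thus "X \<in> separators I z \<and> Y \<in> separators I z" using half[OF XI IU eq] by blast
qed

text \<open>
  The complement of a down-set of an equivalence relation is again one, so tightness applied to a set
  and its complement determines the lattice.
\<close>
lemma down_sets_equiv:
  assumes z: "z \<in> submodular_funs I" and P: "P \<in> Pre I z" and td: "totally_disconnected I P"
  shows "down_sets I P = separators I z"
proof -
  have po: "preorder_on I P" using P by (simp add: Pre_def)
  have T: "tight_lattice I z (down_sets I P)"
    by (rule Pre_iff_tight_lattice[OF z po, THEN iffD1, OF P])
  note D = tight_latticeD[OF T]
  have sym: "(x, y) \<in> P \<Longrightarrow> (y, x) \<in> P" for x y
    using td by (auto simp: totally_disconnected_def equiv_def sym_def)
  have PI: "(x, y) \<in> P \<Longrightarrow> x \<in> I" for x y using po by (auto simp: preorder_on_def)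
  show ?thesis
  proof (rule subset_antisym; rule subsetI)
    fix A assume A: "A \<in> down_sets I P"
    hence AI: "A \<subseteq> I" using D(1) by auto
    have "I - A \<in> down_sets I P"
      using A sym PI unfolding down_sets_def down_set_def by blast
    from D(7)[OF A this] have "z A + z (I - A) = z {} + z I"
      using AI by (simp add: Un_absorb1)
    thus "A \<in> separators I z" using AI submodular_empty[OF z] by (simp add: separators_def)
  next
    fix A assume A: "A \<in> separators I z"
    have AI: "A \<subseteq> I" "I - A \<subseteq> I" using A by (auto simp: separators_def)
    have e: "A \<inter> (I - A) = {}" "A \<union> (I - A) = I" using AI by auto
    have "z A + z (I - A) = z {} + z I"
      using A submodular_empty[OF z] by (simp add: separators_def)
    thus "A \<in> down_sets I P" using D(8)[OF AI, unfolded e] D(2,3) by blast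
  qed
qed

text \<open>The separators are closed under complement, so their preorder is symmetric.\<close>
lemma ex1_equiv_in_Pre:
  assumes fin: "finite I" and z: "z \<in> submodular_funs I"
  obtains Q where "Q \<in> Pre I z" "totally_disconnected I Q" "lower_fun I Q z = z"
    "\<And>P. P \<in> Pre I z \<Longrightarrow> totally_disconnected I P \<Longrightarrow> P = Q"
proof -
  obtain Q where Q: "preorder_on I Q" "down_sets I Q = separators I z"
    by (rule ex_preorder_with_tight_lattice[OF fin separators_tight[OF z]])
  have QP: "Q \<in> Pre I z"
    unfolding Pre_iff_tight_lattice[OF z Q(1)] Q(2) by (rule separators_tight[OF z])
  have sep: "down_set I Q A \<longleftrightarrow> A \<in> separators I z" for A using Q(2) by (auto simp: down_sets_def)
  have "sym Q"
  proof (rule symI)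
    fix x y assume xy: "(x, y) \<in> Q"
    have tr: "(a, b) \<in> Q \<Longrightarrow> (b, c) \<in> Q \<Longrightarrow> (a, c) \<in> Q" for a b c
      using Q(1) by (auto simp: preorder_on_def trans_def)
    have QI: "(a, b) \<in> Q \<Longrightarrow> a \<in> I \<and> b \<in> I" for a b using Q(1) by (auto simp: preorder_on_def)
    let ?A = "{v. (v, x) \<in> Q}"
    have "down_set I Q ?A" using tr QI unfolding down_set_def by blast
    hence "down_set I Q (I - ?A)" unfolding sep by (rule separators_Diff)
    moreover have "x \<in> ?A" using Q(1) QI[OF xy] by (auto simp: preorder_on_def refl_on_def)
    ultimately show "(y, x) \<in> Q" using xy QI[OF xy] unfolding down_set_def by blast
  qed
  hence td: "totally_disconnected I Q"
    using Q(1) by (simp add: totally_disconnected_def equiv_def preorder_on_def)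
  interpret compatible_preorder I Q z
    using fin z Q(1) QP by unfold_locales (auto simp: Pre_def conforms_def)
  have "w E = z E" if E: "E \<subseteq> I" for E
  proof -
    have "w (E \<inter> D) = z (E \<inter> D)" if "down_set I Q D" for D
      using that
    proof (induction rule: down_set_induct)
      case empty
      show ?case using lower_empty submodular_empty[OF z] by simp
    next
      case (add A C)
      note AC = adds_bubbleD[OF add(1)]
      have A: "A \<in> separators I z" using AC(1) sep by blast
      have e: "(A \<union> (E \<inter> C)) \<inter> A = A" "(A \<union> (E \<inter> C)) - A = E \<inter> C"
        "(E \<inter> (A \<union> C)) \<inter> A = E \<inter> A" "(E \<inter> (A \<union> C)) - A = E \<inter> C" using AC(3) by auto
      have s: "A \<union> (E \<inter> C) \<subseteq> I" "E \<inter> (A \<union> C) \<subseteq> I" "E \<inter> C \<subseteq> I" using AC(5) E by auto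
      obtain a where a: "z A = ereal a" using down_set_realE[OF AC(1)] by blast
      have "z (A \<union> (E \<inter> C)) - z A = z (E \<inter> C)"
        using separator_split[OF z A s(1)] submodular_not_MInfty[OF z s(3)] unfolding e a
        by (cases "z (E \<inter> C)") simp_all
      thus ?case
        using lower_cut[OF add(1) E] separator_split[OF z A s(2)] add(2) unfolding e by simp
    qed
    from this[OF down_set_top[OF Q(1)]] show ?thesis using E by (simp add: Int_absorb2)
  qed
  hence "w = z"
    using lower_submodular z
    by (intro extensionalityI[of _ "Pow I"]) (auto simp: submodular_funs_def PiE_iff)
  moreover have "P = Q" if "P \<in> Pre I z" "totally_disconnected I P" for P
    using that Q down_sets_equiv[OF z that] by (intro preorder_eq_if_down_sets) (auto simp: Pre_def)
  ultimately show thesis using that QP td by blast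
qed

section \<open>Coproducts on basis vectors\<close>

lemma free_space_linear_eqI:
  assumes "linear f" "linear g" "v \<in> free_space X"
    and eq: "\<And>x. x \<in> X \<Longrightarrow> f (basis_vec x) = g (basis_vec x)"
  shows "f v = g v"
proof (rule linear_eq_on_span[OF assms(1,2) _ assms(3)[unfolded free_space_def]])
  show "f b = g b" if "b \<in> basis_vec ` X" for b using that eq by blast
qed

lemma free_space_linear_in_span:
  assumes "linear f" "v \<in> free_space X" "\<And>x. x \<in> X \<Longrightarrow> f (basis_vec x) \<in> span T"
  shows "f v \<in> span T"
proof -
  have "free_space X \<subseteq> f -` span T"
    unfolding free_space_def
    by (intro span_minimal linear_subspace_vimage assms(1) subspace_span) (use assms(3) in auto)
  thus ?thesis using assms(2) by blast
qed

lemma tensor_basis_vec [simp]: "tensor (basis_vec b) (basis_vec c) = basis_vec (b, c)"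
  by (simp add: tensor_def)

lemma tensor_map_basis_vec [simp]:
  "tensor_map f g (basis_vec (b, c)) = tensor (f (basis_vec b)) (g (basis_vec c))"
  by (simp add: tensor_map_def)

lemma tensor_assoc_basis_vec [simp]:
  "tensor_assoc (basis_vec ((b, c), d)) = basis_vec (b, c, d)"
  by (simp add: tensor_assoc_def)

lemma linear_tensor_map: "linear (tensor_map f g)"
  unfolding tensor_map_def by (rule linear_lin_extend)

lemma linear_tensor_assoc: "linear tensor_assoc"
  unfolding tensor_assoc_def by (rule linear_lin_extend)

lemma linear_tensor_functional: "linear (tensor_functional f \<phi>)"
  unfolding tensor_functional_def by (rule linear_lin_extend)

lemma basis_vec_SM: "z \<in> submodular_funs I \<Longrightarrow> basis_vec z \<in> SM I"
  unfolding SM_def free_space_def by (rule span_base[OF imageI])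

lemma basis_vec_MOD: "z \<in> modular_funs I \<Longrightarrow> basis_vec z \<in> MOD I"
  unfolding MOD_def free_space_def by (rule span_base[OF imageI])

lemma modular_imp_submodular: "z \<in> modular_funs I \<Longrightarrow> z \<in> submodular_funs I"
  by (simp add: modular_funs_def)

lemma finite_Pre:
  assumes "finite I"
  shows "finite (Pre I z)"
proof (rule finite_subset)
  show "Pre I z \<subseteq> Pow (I \<times> I)" by (auto simp: Pre_def preorder_on_def)
  show "finite (Pow (I \<times> I))" using assms by simp
qed

lemma compatible_preorderI:
  assumes "finite I" "z \<in> submodular_funs I" "Q \<in> Pre I z"
  shows "compatible_preorder I Q z"
proof
  show "preorder_on I Q" "compatible I Q z" using assms(3) by (simp_all add: Pre_def conforms_def)
qed (fact assms)+

text \<open>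
  The coproducts are \<open>undefined\<close> outside their domains and need not be linear as total functions; this
  linear extension agrees with them where they are defined.
\<close>
abbreviation linear_delta where
  "linear_delta I \<equiv> lin_extend (\<lambda>z. \<Sum>Q\<in>Pre I z.
     tensor (basis_vec (lower_fun I Q z)) (basis_vec (upper_fun I Q z)))"

lemma delta_SM_eq: "v \<in> SM I \<Longrightarrow> delta_SM I v = linear_delta I v"
  by (simp add: delta_SM_def)

lemma delta_MOD_eq: "v \<in> MOD I \<Longrightarrow> delta_MOD I v = delta_SM I v"
  by (simp add: delta_MOD_def)

lemma delta_SM_basis_vec:
  "z \<in> submodular_funs I \<Longrightarrow>
     delta_SM I (basis_vec z) = (\<Sum>Q\<in>Pre I z. basis_vec (lower_fun I Q z, upper_fun I Q z))"
  by (simp add: delta_SM_eq[OF basis_vec_SM])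

text \<open>
  Coassociativity as a change of summation index: the pair \<open>(Q, P)\<close> on the left, a face of a face,
  corresponds to the pair \<open>(R, Q)\<close> on the right with \<open>R\<close> the glued preorder and
  \<open>P = R \<inter> Q \<inter> Q\<inverse>\<close>.
\<close>
lemma sum_Pre_Pre_lower:
  fixes f :: "('a set \<Rightarrow> ereal) \<times> ('a set \<Rightarrow> ereal) \<times> ('a set \<Rightarrow> ereal) \<Rightarrow> 'v::comm_monoid_add"
  assumes fin: "finite I" and z: "z \<in> submodular_funs I"
  shows "(\<Sum>Q\<in>Pre I z. \<Sum>P\<in>Pre I (lower_fun I Q z).
      f (lower_fun I P (lower_fun I Q z), upper_fun I P (lower_fun I Q z), upper_fun I Q z))
    = (\<Sum>R\<in>Pre I z. \<Sum>Q\<in>Pre I (upper_fun I R z).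
      f (lower_fun I R z, lower_fun I Q (upper_fun I R z), upper_fun I Q (upper_fun I R z)))"
    (is "?l = ?r")
proof -
  let ?S = "SIGMA Q:Pre I z. Pre I (lower_fun I Q z)"
  let ?T = "SIGMA R:Pre I z. Pre I (upper_fun I R z)"
  have T: "(R, Q) \<in> ?T \<longleftrightarrow> R \<in> Pre I z \<and> Q \<in> Pre I z \<and> down_sets I Q \<subseteq> down_sets I R" for R Q
    using Pre_upper_iff[OF z] by blast
  have "?l = (\<Sum>(Q, P)\<in>?S.
      f (lower_fun I P (lower_fun I Q z), upper_fun I P (lower_fun I Q z), upper_fun I Q z))"
    by (rule sum.Sigma) (simp_all add: finite_Pre[OF fin])
  also have "\<dots> = (\<Sum>(R, Q)\<in>?T.
      f (lower_fun I R z, lower_fun I Q (upper_fun I R z), upper_fun I Q (upper_fun I R z)))"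
  proof (rule sum.reindex_bij_witness[of _ "\<lambda>(R, Q). (Q, R \<inter> (Q \<inter> Q\<inverse>))"
        "\<lambda>(Q, P). (compatible_preorder.glue I Q z P, Q)"])
    fix a assume "a \<in> ?S"
    then obtain Q P where a: "a = (Q, P)" and Q: "Q \<in> Pre I z" and P: "P \<in> Pre I (lower_fun I Q z)"
      by auto
    interpret compatible_preorder I Q z by (rule compatible_preorderI[OF fin z Q])
    note R = glue_in_Pre[OF P] and QR = down_sets_subset_glue[OF P] and eq = glue_Int_bubbles[OF P]
    show "(case case a of (Q, P) \<Rightarrow> (compatible_preorder.glue I Q z P, Q) of
        (R, Q) \<Rightarrow> (Q, R \<inter> (Q \<inter> Q\<inverse>))) = a"
      using eq by (simp add: a)
    show "(case a of (Q, P) \<Rightarrow> (compatible_preorder.glue I Q z P, Q)) \<in> ?T"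
      unfolding a prod.case T using R Q QR by blast
    have "lower_fun I (glue P) z = lower_fun I P (lower_fun I Q z)"
      using lower_lower[OF R QR] by (simp only: eq)
    moreover have "lower_fun I Q (upper_fun I (glue P) z) = upper_fun I P (lower_fun I Q z)"
      using lower_upper[OF Q R QR] by (simp only: eq)
    moreover have "upper_fun I Q (upper_fun I (glue P) z) = upper_fun I Q z"
      by (rule upper_upper[OF QR])
    ultimately show "(case case a of (Q, P) \<Rightarrow> (compatible_preorder.glue I Q z P, Q) of
        (R, Q) \<Rightarrow> f (lower_fun I R z, lower_fun I Q (upper_fun I R z),
          upper_fun I Q (upper_fun I R z)))
      = (case a of (Q, P) \<Rightarrow>
        f (lower_fun I P (lower_fun I Q z), upper_fun I P (lower_fun I Q z), upper_fun I Q z))"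
      by (simp only: a prod.case)
  next
    fix b assume b': "b \<in> ?T"
    obtain R Q where b: "b = (R, Q)" by (cases b)
    have R: "R \<in> Pre I z" and Q: "Q \<in> Pre I z" and QR: "down_sets I Q \<subseteq> down_sets I R"
      using b' unfolding b T by blast+
    interpret compatible_preorder I Q z by (rule compatible_preorderI[OF fin z Q])
    show "(case case b of (R, Q) \<Rightarrow> (Q, R \<inter> (Q \<inter> Q\<inverse>)) of
        (Q, P) \<Rightarrow> (compatible_preorder.glue I Q z P, Q)) = b"
      by (simp only: b prod.case glue_of_Int_bubbles[OF R QR])
    show "(case b of (R, Q) \<Rightarrow> (Q, R \<inter> (Q \<inter> Q\<inverse>))) \<in> ?S"
      unfolding b prod.case using Q Int_bubbles_in_Pre[OF R QR] by blast
  qed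
  also have "\<dots> = ?r"
    by (rule sum.Sigma[symmetric]) (simp_all add: finite_Pre[OF fin])
  finally show ?thesis .
qed

text \<open>
  The map \<open>d\<close> stands for either coproduct, since they agree on the lower functions of modular
  functions.
\<close>
lemma coassoc_basis_vec:
  assumes fin: "finite I" and z: "z \<in> submodular_funs I"
    and d: "\<And>Q. Q \<in> Pre I z \<Longrightarrow> d (basis_vec (lower_fun I Q z)) = delta_SM I (basis_vec (lower_fun I Q z))"
  shows "tensor_assoc (tensor_map d id (delta_SM I (basis_vec z)))
    = tensor_map id (delta_MOD I) (delta_SM I (basis_vec z))"
proof -
  have "tensor_assoc (tensor_map d id (basis_vec (lower_fun I Q z, upper_fun I Q z)))
      = (\<Sum>P\<in>Pre I (lower_fun I Q z). basis_vec (lower_fun I P (lower_fun I Q z),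
          upper_fun I P (lower_fun I Q z), upper_fun I Q z))" if Q: "Q \<in> Pre I z" for Q
  proof -
    interpret compatible_preorder I Q z by (rule compatible_preorderI[OF fin z Q])
    show ?thesis
      by (simp add: d[OF Q] delta_SM_basis_vec[OF lower_submodular] linear_sum[OF linear_tensor_left]
          linear_sum[OF linear_tensor_assoc])
  qed
  moreover have "tensor_map id (delta_MOD I) (basis_vec (lower_fun I R z, upper_fun I R z))
      = (\<Sum>Q\<in>Pre I (upper_fun I R z). basis_vec (lower_fun I R z,
          lower_fun I Q (upper_fun I R z), upper_fun I Q (upper_fun I R z)))"
    if R: "R \<in> Pre I z" for R
    using upper_modular[OF z R]
    by (simp add: delta_MOD_eq[OF basis_vec_MOD] delta_SM_basis_vec[OF modular_imp_submodular]
        linear_sum[OF linear_tensor_right])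
  ultimately show ?thesis
    unfolding delta_SM_basis_vec[OF z]
    by (simp add: linear_sum[OF linear_tensor_map] linear_sum[OF linear_tensor_assoc]
        sum_Pre_Pre_lower[OF fin z])
qed

lemma counit_basis_vec:
  assumes fin: "finite I" and z: "z \<in> submodular_funs I"
  shows "tensor_functional id (eps_MOD I) (delta_SM I (basis_vec z)) = basis_vec z"
proof -
  obtain Q where Q: "Q \<in> Pre I z" "totally_disconnected I Q" "lower_fun I Q z = z"
    and uniq: "\<And>P. P \<in> Pre I z \<Longrightarrow> totally_disconnected I P \<Longrightarrow> P = Q"
    using ex1_equiv_in_Pre[OF fin z] by blast
  have "tensor_functional id (eps_MOD I) (basis_vec (lower_fun I P z, upper_fun I P z))
      = (if P = Q then basis_vec z else 0)" if P: "P \<in> Pre I z" for P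
  proof -
    have "eps_MOD I (basis_vec (upper_fun I P z)) = (if totally_disconnected I P then 1 else 0)"
      using basis_vec_MOD[OF upper_modular[OF z P]] pre_upper[OF fin z P] by (simp add: eps_MOD_def)
    moreover have "totally_disconnected I P \<longleftrightarrow> P = Q" using uniq[OF P] Q(2) by blast
    ultimately show ?thesis using Q(3) by (simp add: tensor_functional_def)
  qed
  thus ?thesis
    unfolding delta_SM_basis_vec[OF z]
    using Q(1) by (simp add: linear_sum[OF linear_tensor_functional] finite_Pre[OF fin])
qed

theorem proposition12p2:
  fixes I :: "'a set"
  assumes "finite I"
  shows "delta_MOD I \<in> MOD I \<rightarrow> tensor_space (MOD I) (MOD I) \<and>
         (\<forall>v\<in>MOD I.
            tensor_assoc (tensor_map (delta_MOD I) id (delta_MOD I v))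
              = tensor_map id (delta_MOD I) (delta_MOD I v)) \<and>
         delta_SM I \<in> SM I \<rightarrow> tensor_space (SM I) (MOD I) \<and>
         (\<forall>v\<in>SM I.
            tensor_assoc (tensor_map (delta_SM I) id (delta_SM I v))
              = tensor_map id (delta_MOD I) (delta_SM I v)) \<and>
         (\<forall>v\<in>SM I. tensor_functional id (eps_MOD I) (delta_SM I v) = v)"
proof (intro conjI ballI Pi_I)
  have coassoc: "tensor_assoc (tensor_map d id (delta_SM I v)) = tensor_map id (delta_MOD I) (delta_SM I v)"
    if v: "v \<in> free_space X" and X: "X \<subseteq> submodular_funs I"
      and d: "\<And>z Q. z \<in> X \<Longrightarrow> Q \<in> Pre I z \<Longrightarrow>
        d (basis_vec (lower_fun I Q z)) = delta_SM I (basis_vec (lower_fun I Q z))" for d X v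
  proof -
    have "free_space X \<subseteq> SM I"
      unfolding SM_def free_space_def by (intro span_mono image_mono X)
    hence vSM: "v \<in> SM I" using v by blast
    have "linear (\<lambda>v. tensor_assoc (tensor_map d id (linear_delta I v)))"
      using linear_compose[OF linear_compose[OF linear_lin_extend linear_tensor_map] linear_tensor_assoc]
      by (simp add: o_def)
    moreover have "linear (\<lambda>v. tensor_map id (delta_MOD I) (linear_delta I v))"
      using linear_compose[OF linear_lin_extend linear_tensor_map] by (simp add: o_def)
    moreover have "tensor_assoc (tensor_map d id (linear_delta I (basis_vec z)))
        = tensor_map id (delta_MOD I) (linear_delta I (basis_vec z))" if "z \<in> X" for z
      using coassoc_basis_vec[OF assms, of z d] d[OF that] X that
      unfolding delta_SM_eq[OF basis_vec_SM[OF subsetD[OF X that]]] by blast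
    ultimately have "tensor_assoc (tensor_map d id (linear_delta I v))
        = tensor_map id (delta_MOD I) (linear_delta I v)"
      by (rule free_space_linear_eqI[OF _ _ v])
    thus ?thesis by (simp only: delta_SM_eq[OF vSM])
  qed
  have lower_mod: "lower_fun I Q z \<in> modular_funs I" if "z \<in> modular_funs I" "Q \<in> Pre I z" for z Q
    by (rule compatible_preorder.lower_modular[OF compatible_preorderI[OF assms
          modular_imp_submodular[OF that(1)] that(2)] that(1)])
  show "tensor_assoc (tensor_map (delta_SM I) id (delta_SM I v))
      = tensor_map id (delta_MOD I) (delta_SM I v)" if "v \<in> SM I" for v
    by (rule coassoc[OF that[unfolded SM_def] subset_refl refl])
  show "tensor_assoc (tensor_map (delta_MOD I) id (delta_MOD I v))
      = tensor_map id (delta_MOD I) (delta_MOD I v)" if "v \<in> MOD I" for v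
    unfolding delta_MOD_eq[OF that]
  proof (rule coassoc[OF that[unfolded MOD_def]])
    show "modular_funs I \<subseteq> submodular_funs I" using modular_imp_submodular by blast
    show "delta_MOD I (basis_vec (lower_fun I Q z)) = delta_SM I (basis_vec (lower_fun I Q z))"
      if "z \<in> modular_funs I" "Q \<in> Pre I z" for z Q
      by (rule delta_MOD_eq[OF basis_vec_MOD[OF lower_mod[OF that]]])
  qed
  have in_tensor: "delta_SM I v \<in> tensor_space V (MOD I)"
    if v: "v \<in> free_space X" and X: "X \<subseteq> submodular_funs I"
      and V: "\<And>z Q. z \<in> X \<Longrightarrow> Q \<in> Pre I z \<Longrightarrow> basis_vec (lower_fun I Q z) \<in> V" for v X V
  proof -
    have "free_space X \<subseteq> SM I"
      unfolding SM_def free_space_def by (intro span_mono image_mono X)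
    hence vSM: "v \<in> SM I" using v by blast
    have "linear_delta I (basis_vec z) \<in> tensor_space V (MOD I)" if "z \<in> X" for z
      unfolding tensor_space_def lin_extend_basis_vec
    proof (intro span_sum span_base)
      fix Q assume Q: "Q \<in> Pre I z"
      have "basis_vec (upper_fun I Q z) \<in> MOD I"
        by (rule basis_vec_MOD[OF upper_modular[OF subsetD[OF X that] Q]])
      thus "tensor (basis_vec (lower_fun I Q z)) (basis_vec (upper_fun I Q z))
          \<in> {tensor u v |u v. u \<in> V \<and> v \<in> MOD I}"
        using V[OF that Q] by blast
    qed
    thus ?thesis unfolding delta_SM_eq[OF vSM] tensor_space_def
      by (rule free_space_linear_in_span[OF linear_lin_extend v])
  qed
  show "delta_SM I v \<in> tensor_space (SM I) (MOD I)" if "v \<in> SM I" for v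
  proof (rule in_tensor[OF that[unfolded SM_def] subset_refl])
    show "basis_vec (lower_fun I Q z) \<in> SM I" if "z \<in> submodular_funs I" "Q \<in> Pre I z" for z Q
      by (rule basis_vec_SM[OF compatible_preorder.lower_submodular[OF
            compatible_preorderI[OF assms that]]])
  qed
  show "delta_MOD I v \<in> tensor_space (MOD I) (MOD I)" if "v \<in> MOD I" for v
    unfolding delta_MOD_eq[OF that]
  proof (rule in_tensor[OF that[unfolded MOD_def]])
    show "modular_funs I \<subseteq> submodular_funs I" using modular_imp_submodular by blast
    show "basis_vec (lower_fun I Q z) \<in> MOD I" if "z \<in> modular_funs I" "Q \<in> Pre I z" for z Q
      by (rule basis_vec_MOD[OF lower_mod[OF that]])
  qed
  show "tensor_functional id (eps_MOD I) (delta_SM I v) = v" if v: "v \<in> SM I" for v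
  proof -
    have "linear (\<lambda>v. tensor_functional id (eps_MOD I) (linear_delta I v))"
      using linear_compose[OF linear_lin_extend linear_tensor_functional] by (simp add: o_def)
    moreover have "tensor_functional id (eps_MOD I) (linear_delta I (basis_vec z)) = basis_vec z"
      if "z \<in> submodular_funs I" for z
      using counit_basis_vec[OF assms that] by (simp only: delta_SM_eq[OF basis_vec_SM[OF that]])
    ultimately have "tensor_functional id (eps_MOD I) (linear_delta I v) = v"
      by (rule free_space_linear_eqI[OF _ linear_ident v[unfolded SM_def]])
    thus ?thesis by (simp only: delta_SM_eq[OF v])
  qed
qed

end
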